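(* Let $\ell:\mathcal{Y}\times\mathcal{Y}\to[0,1]$ be a loss function, let $2\le n_L<n$ and $m\ge1$ be integers, and let $D_1,\dots,D_n$ be probability distributions on $\mathcal{X}\times\mathcal{Y}$. Let $\pi\in\mathcal{M}(\mathcal{A})$ be any fixed meta-prior, $\mathcal{P}\in\mathcal{M}(\mathcal{M}(\mathcal{F}))$ any fixed hyper-prior, and let $\delta>0$. Then, with probability at least $1-\delta$ over the random choice of the set $I_L\subset\{1,\dots,n\}$ of $n_L$ labeled tasks and the sampling of the datasets, the following holds simultaneously for all distributions $\rho\in\mathcal{M}(\mathcal{A})$ over algorithms and all hyper-posterior functions $\mathcal{Q}:\mathcal{A}\to\mathcal{M}(\mathcal{M}(\mathcal{F}))$: $$ \mathcal{R}(\rho)\le\widehat{\mathcal{R}}(\rho)+\sqrt{\Big(1-\frac{n_L}{n}\Big)\frac{\mathbf{KL}(\rho\|\pi)+\log\big(\frac{t(n_L,n)}{\delta}\big)}{2n_L}}+\mathbb{E}_{A\sim\rho}\sqrt{\frac{C(A,\mathcal{Q},\mathcal{P})+\log\big(\frac{8mn}{\delta}\big)+1}{2mn}}, $$ where $$ C(A,\mathcal{Q},\mathcal{P})=\mathbf{KL}(\mathcal{Q}(A)\|\mathcal{P})+\mathbb{E}_{P\sim\mathcal{Q}(A)}\sum_{i=1}^n\mathbf{KL}(A(X_i)\|P) $$ and $t(n_L,n)=3\log(n_L)\sqrt{n_L\left(1-\frac{n_L}{n}\right)}$.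
   Context: Setting (transductive multi-task learning). There are $n$ tasks; task $i$ has a data distribution $D_i$ on $\mathcal{X}\times\mathcal{Y}$ and a dataset $S_i=((x_{i,1},y_{i,1}),\dots,(x_{i,m},y_{i,m}))$ of $m$ i.i.d. samples from $D_i$; the datasets are independent across tasks. Write $X_i=(x_{i,1},\dots,x_{i,m})$ for the inputs of $S_i$. A set $I_L$ of $n_L$ tasks is drawn uniformly at random without replacement from the $n$ tasks, independently of the data. For tasks in $I_L$ the labels are observed; for the remaining tasks only $X_i$ is observed (their labels exist but are unknown). $\mathcal{F}$ is a set of models $f:\mathcal{X}\to\mathcal{Y}$, and $\mathcal{M}(E)$ denotes the set of probability distributions on a space $E$. $\mathcal{A}$ is a family of algorithms; each $A\in\mathcal{A}$ maps an unlabeled dataset (a finite collection of elements of $\mathcal{X}$) to a distribution in $\mathcal{M}(\mathcal{F})$, so that $A(X_i)$ is the posterior of task $i$. A meta-prior $\pi$ is a data-independent distribution over $\mathcal{A}$; a hyper-prior $\mathcal{P}$ is a data-independent distribution over priors $P\in\mathcal{M}(\mathcal{F})$. A hyper-posterior function $\mathcal{Q}$ assigns to each $A\in\mathcal{A}$ a distribution $\mathcal{Q}(A)$ over priors. Both $\rho$ and $\mathcal{Q}$ may depend on the data. All objects are assumed measurable as needed. $\mathbf{KL}$ is the Kullback-Leibler divergence and $\log$ is the natural logarithm. True risk over all tasks: $$\mathcal{R}(\rho)=\mathbb{E}_{A\sim\rho}\frac1n\sum_{i=1}^n\mathbb{E}_{(x,y)\sim D_i}\mathbb{E}_{f\sim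 A(X_i)}\,\ell(y,f(x)).$$ Training risk over the labeled tasks: $$\widehat{\mathcal{R}}(\rho)=\mathbb{E}_{A\sim\rho}\frac1{n_L}\sum_{i\in I_L}\frac1m\sum_{j=1}^m\mathbb{E}_{f\sim A(X_i)}\,\ell(y_{i,j},f(x_{i,j})).$$ *)

theory Defs
  imports "HOL-Probability.Probability"
begin

text \<open>
  Measurable structure on a set of distributions \<open>\<M>(E)\<close> is that of the Giry monad, so
  \<open>\<M>(E)\<close> is \<open>space (prob_algebra E)\<close> and \<open>\<M>(\<M>(E))\<close> is \<open>space (prob_algebra (prob_algebra E))\<close>.
  Tasks and sample points are numbered from \<open>0\<close>.  A dataset is a function \<open>s\<close> with
  \<open>s j = (x\<^sub>j, y\<^sub>j)\<close> for \<open>j < m\<close>; a family of datasets \<open>S\<close> has \<open>S i\<close> as the dataset of task \<open>i\<close>.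
\<close>

type_synonym ('x, 'y) model = "'x \<Rightarrow> 'y"

type_synonym ('x, 'y) algorithm = "'x list \<Rightarrow> ('x, 'y) model measure"

type_synonym ('x, 'y) datasets = "nat \<Rightarrow> nat \<Rightarrow> 'x \<times> 'y"

text \<open>
  The library's \<^const>\<open>KL_divergence\<close> is a Bochner integral (divergence of its third argument
  from its second one, with the base of the logarithm as first argument), which is \<open>0\<close> when the
  log-density is not integrable.  For probability measures with \<open>Q\<close> absolutely continuous with
  respect to \<open>P\<close> the negative part of the log-density is always \<open>Q\<close>-integrable, so
  non-integrability means that the divergence is infinite.
\<close>

definition KL :: "'a measure \<Rightarrow> 'a measure \<Rightarrow> ennreal" where
  "KL Q P =
     (if absolutely_continuous P Q \<and> integrable Q (entropy_density (exp 1) P Q)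
      then ennreal (KL_divergence (exp 1) P Q) else \<infinity>)"

definition ereal_sqrt :: "ereal \<Rightarrow> ereal" where
  "ereal_sqrt x = (if x = \<infinity> then \<infinity> else ereal (sqrt (real_of_ereal x)))"

definition inputs :: "nat \<Rightarrow> (nat \<Rightarrow> 'x \<times> 'y) \<Rightarrow> 'x list" where
  "inputs m s = map (\<lambda>j. fst (s j)) [0..<m]"

definition sampling ::
  "nat \<Rightarrow> nat \<Rightarrow> nat \<Rightarrow> (nat \<Rightarrow> ('x \<times> 'y) measure) \<Rightarrow> (nat set \<times> ('x, 'y) datasets) measure" where
  "sampling n nL m D =
     measure_pmf (pmf_of_set {I. I \<subseteq> {..<n} \<and> card I = nL}) \<Otimes>\<^sub>M
     (\<Pi>\<^sub>M i\<in>{..<n}. \<Pi>\<^sub>M j\<in>{..<m}. D i)"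

definition true_risk ::
  "nat \<Rightarrow> nat \<Rightarrow> (nat \<Rightarrow> ('x \<times> 'y) measure) \<Rightarrow> ('y \<Rightarrow> 'y \<Rightarrow> real) \<Rightarrow>
   ('x, 'y) datasets \<Rightarrow> ('x, 'y) algorithm measure \<Rightarrow> real" where
  "true_risk n m D loss S \<rho> =
     (\<integral>A. 1 / real n * (\<Sum>i<n. \<integral>(x, y). (\<integral>f. loss y (f x) \<partial>A (inputs m (S i))) \<partial>D i) \<partial>\<rho>)"

definition training_risk ::
  "nat \<Rightarrow> nat \<Rightarrow> ('y \<Rightarrow> 'y \<Rightarrow> real) \<Rightarrow> nat set \<Rightarrow>
   ('x, 'y) datasets \<Rightarrow> ('x, 'y) algorithm measure \<Rightarrow> real" where
  "training_risk nL m loss I S \<rho> =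
     (\<integral>A. 1 / real nL * (\<Sum>i\<in>I. 1 / real m *
        (\<Sum>j<m. \<integral>f. loss (snd (S i j)) (f (fst (S i j))) \<partial>A (inputs m (S i)))) \<partial>\<rho>)"

text \<open>
  The integrand below need not be measurable for arbitrary measurable spaces, and neither need
  the one in the last definition, where \<open>\<Q>\<close> is an arbitrary function.  The Lebesgue integral
  of a nonnegative function is the supremum over the simple functions below it, so for a
  non-measurable integrand it is the lower integral, the smallest sensible reading of the
  expectation; for measurable integrands it is the usual one.
\<close>

definition complexity ::
  "nat \<Rightarrow> nat \<Rightarrow> ('x, 'y) datasets \<Rightarrow> ('x, 'y) algorithm \<Rightarrow>
   (('x, 'y) algorithm \<Rightarrow> ('x, 'y) model measure measure) \<Rightarrow>
   ('x, 'y) model measure measure \<Rightarrow> ennreal" where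
  "complexity n m S A \<Q> \<P> =
     KL (\<Q> A) \<P> + (\<integral>\<^sup>+P. (\<Sum>i<n. KL (A (inputs m (S i))) P) \<partial>\<Q> A)"

definition t_factor :: "nat \<Rightarrow> nat \<Rightarrow> real" where
  "t_factor nL n = 3 * ln (real nL) * sqrt (real nL * (1 - real nL / real n))"

definition labeled_task_term ::
  "nat \<Rightarrow> nat \<Rightarrow> real \<Rightarrow> 'a measure \<Rightarrow> 'a measure \<Rightarrow> ereal" where
  "labeled_task_term n nL \<delta> \<rho> \<pi> =
     ereal_sqrt (ereal (1 - real nL / real n) *
       ((enn2ereal (KL \<rho> \<pi>) + ereal (ln (t_factor nL n / \<delta>))) / ereal (2 * real nL)))"

text \<open>
  The radicand in the next definition is negative only if \<open>\<delta> > 1\<close>, so the conversion to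
  \<^typ>\<open>ennreal\<close> truncates nothing for \<open>\<delta> \<le> 1\<close>.
\<close>

definition sample_term ::
  "nat \<Rightarrow> nat \<Rightarrow> real \<Rightarrow> ('x, 'y) datasets \<Rightarrow> ('x, 'y) algorithm measure \<Rightarrow>
   (('x, 'y) algorithm \<Rightarrow> ('x, 'y) model measure measure) \<Rightarrow>
   ('x, 'y) model measure measure \<Rightarrow> ereal" where
  "sample_term n m \<delta> S \<rho> \<Q> \<P> =
     enn2ereal (\<integral>\<^sup>+A. e2ennreal (ereal_sqrt
       ((enn2ereal (complexity n m S A \<Q> \<P>) + ereal (ln (8 * real m * real n / \<delta>) + 1))
         / ereal (2 * real m * real n))) \<partial>\<rho>)"

end

theory Submission
  imports Defs
begin

text \<open>
  Insert the average empirical risk of all \<open>n\<close> tasks between the true and the training risk.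

  Between the empirical averages over all tasks and over the labeled ones, the gap for a fixed
  algorithm comes from sampling without replacement.  Serfling's martingale argument gives it a
  sub-Gaussian moment generating function whose variance proxy is \<open>(1 - n\<^sub>L / n) / (4 n\<^sub>L)\<close> up to lower
  order terms.  A mixture over finitely many slopes of the exponential, integrated against the
  meta-prior, then dominates \<open>exp (2 n\<^sub>L gap\<^sup>2 / (1 - n\<^sub>L / n))\<close> up to the factor \<open>t\<close>, but only where
  that quantity exceeds \<open>t\<close>, which is all that is needed.

  Between the true and the empirical risk of all tasks the same mixture is used for \<open>m n\<close> independent
  samples with Hoeffding's lemma, integrated against the hyper-prior and against one draw of a model per
  task from the common prior \<open>P\<close>.  This measure does not depend on the algorithm, so the bound holds
  for all algorithms at once and no divergence of \<open>\<rho>\<close> is paid.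

  Both mixtures have expectation at most one.  Markov's inequality is applied to their convex
  combination with weights \<open>47/50\<close> and \<open>3/50\<close>: the second bound is loose enough for the small weight,
  while the first is nearly tight for \<open>n\<^sub>L = 2\<close> and \<open>n = 3, 4\<close>.  The variational formula for
  the divergence turns the integrals against priors into bounds for all posteriors.
\<close>

section \<open>Slopes of the exponential mixture\<close>

text \<open>Since e < 68/25, the claim follows from a comparison of powers of natural numbers that
  \<open>simp\<close> can decide. Most numerical bounds on logarithms in
  \<open>labeled_cover\<close> are instances.\<close>

lemma ln_ge_ratio:
  fixes a b c d :: nat
  assumes "68 ^ a * d ^ b \<le> 25 ^ a * c ^ b" and "0 < b" and "0 < c" and "0 < d"
  shows "real a / real b \<le> ln (real c / real d)"
proof -
  have "exp (real a) = exp 1 ^ a"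
    by (simp add: exp_of_nat_mult[symmetric])
  also have "\<dots> \<le> (68/25) ^ a"
    using e_less_272 by (intro power_mono) auto
  also have "\<dots> \<le> (real c / real d) ^ b"
  proof -
    have "real (68 ^ a * d ^ b) \<le> real (25 ^ a * c ^ b)" using assms(1) by (simp only: of_nat_le_iff)
    then show ?thesis using assms by (simp add: power_divide field_simps)
  qed
  finally have "real a \<le> ln ((real c / real d) ^ b)"
    using assms by (simp add: ln_ge_iff)
  also have "\<dots> = real b * ln (real c / real d)"
    using assms by (simp add: ln_realpow)
  finally show ?thesis
    using assms by (simp add: field_simps)
qed

text \<open>Half of the Pade bound \<open>2 * (q - 1) / (q + 1) \<le> ln q\<close>. Being rational,
  it turns a comparison of \<open>ln (sqrt q)\<close> with a linear function of \<open>q\<close>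
  into a quadratic inequality.\<close>

lemma half_ln_ge:
  fixes q :: real
  assumes "1 \<le> q"
  shows "(q - 1) / (q + 1) \<le> ln (sqrt q)"
proof -
  have "2 * (q - 1) / (1 + q) \<le> ln q"
    using ln_inverse_approx_ge[of 1 q] assms by (cases "q = 1") auto
  then show ?thesis using assms by (simp add: ln_sqrt field_simps)
qed

text \<open>When \<open>n - p\<close> of \<open>n\<close> elements are drawn one after the other,
  the draws enter the centred sum with dampings \<open>p / j\<close> for j = n - 1 down to p. This
  is the sum of the squared dampings, Serfling's variance proxy up to a constant.\<close>

definition serfling_factor :: "nat \<Rightarrow> nat \<Rightarrow> real" where
  "serfling_factor p n = (real p)\<^sup>2 * (\<Sum>j=p..<n. 1 / (real j)\<^sup>2)"

text \<open>Telescoping: \<open>1 / j^2\<close> is at most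
  \<open>1 / ((j - 1/2) * (j + 1/2))\<close>, which is
  \<open>1 / (j - 1/2) - 1 / (j + 1/2)\<close>.\<close>

lemma sum_inverse_squares_le:
  assumes "1 \<le> p" and "p \<le> n"
  shows "(\<Sum>j=p..<n. 1 / (real j)\<^sup>2) \<le> 1 / (real p - 1/2) - 1 / (real n - 1/2)"
  using assms(2)
proof (induction n rule: dec_induct)
  case (step n)
  have "1 / (real n)\<^sup>2 \<le> 1 / ((real n - 1/2) * (real n + 1/2))"
    using step assms by (intro divide_left_mono mult_pos_pos) (auto simp: power2_eq_square algebra_simps)
  also have "\<dots> = 1 / (real n - 1/2) - 1 / (real (Suc n) - 1/2)"
    using step assms by (auto simp: divide_simps) (auto simp: algebra_simps)?
  finally show ?case using step by simp
qed simp

text \<open>The leading term \<open>M * m / n\<close> is the one that the final bound can afford.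
  With \<open>M\<close> the larger part of the population, the excess over it stays below a constant
  close to 3/8. \<open>a\<close> and \<open>b\<close> are known lower bounds of \<open>M\<close> and
  \<open>n\<close>, usable because \<open>u / (u - 1/2)\<close> decreases in
  \<open>u\<close>.\<close>

lemma serfling_factor_excess:
  fixes a b :: real
  assumes "1 \<le> m" and "m \<le> M" and "n = M + m" and "a \<le> real M" and "b \<le> real n" and "1 \<le> a" and "1 \<le> b"
  shows "serfling_factor M n \<le> real M * real m / real n + 3/8 * (a / (a - 1/2)) * (b / (b - 1/2))"
proof -
  define x where "x = real M" define w where "w = real m"
  have nx: "real n = x + w" and x: "1 \<le> w" "w \<le> x" using assms by (auto simp: x_def w_def)
  have pos: "0 < x - 1/2" "0 < x + w - 1/2" "0 < x + w" using x by auto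
  have "serfling_factor M n \<le> x\<^sup>2 * (1 / (x - 1/2) - 1 / (x + w - 1/2))"
    unfolding serfling_factor_def x_def[symmetric] using sum_inverse_squares_le[of M n] assms
    by (intro mult_left_mono) (auto simp: x_def w_def)
  also have "\<dots> = x\<^sup>2 * w / ((x - 1/2) * (x + w - 1/2))"
  proof -
    have "1 / (x - 1/2) - 1 / (x + w - 1/2) = w / ((x - 1/2) * (x + w - 1/2))"
      using pos by (subst diff_frac_eq) auto
    then show ?thesis by simp
  qed
  \<comment> \<open>An exact splitting into leading term and excess, from \<open>(x - 1/2) * (x + w
    - 1/2) = x * (x + w) - (2 * x + w - 1/2) / 2\<close>.\<close>
  also have "\<dots> = x * w / (x + w) + x * (w * (2 * x + w - 1/2) / 2) / ((x - 1/2) * (x + w - 1/2) * (x + w))"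
  proof -
    have "x\<^sup>2 * w * (x + w) = x * w * ((x - 1/2) * (x + w - 1/2)) + x * (w * (2 * x + w - 1/2) / 2)"
      by (simp add: field_simps power2_eq_square)
    moreover have "x\<^sup>2 * w / ((x - 1/2) * (x + w - 1/2)) = x\<^sup>2 * w * (x + w) / ((x - 1/2) * (x + w - 1/2) * (x + w))"
      using pos by simp
    moreover have "x * w / (x + w) = x * w * ((x - 1/2) * (x + w - 1/2)) / ((x - 1/2) * (x + w - 1/2) * (x + w))"
      using pos by simp
    ultimately show ?thesis by (simp add: add_divide_distrib)
  qed
  finally have main: "serfling_factor M n \<le> \<dots>" .
  have "x * (w * (2 * x + w - 1/2) / 2) / ((x - 1/2) * (x + w - 1/2) * (x + w))
    \<le> x * (3/8 * (x + w)\<^sup>2) / ((x - 1/2) * (x + w - 1/2) * (x + w))"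
  proof -
    \<comment> \<open>The constant 3/8 arises here: \<open>x\<close> is at least half of
      \<open>x + w\<close>, so \<open>x^2\<close> is at least a quarter of
      \<open>(x + w)^2\<close>.\<close>
    have "w * (2 * x + w) = (x + w)\<^sup>2 - x\<^sup>2" by (simp add: algebra_simps power2_eq_square)
    moreover have "((x + w) / 2)\<^sup>2 \<le> x\<^sup>2" using x by (intro power_mono) auto
    ultimately have "w * (2 * x + w) \<le> 3/4 * (x + w)\<^sup>2" by (simp add: power_divide)
    then have "w * (2 * x + w - 1/2) / 2 \<le> 3/8 * (x + w)\<^sup>2" using x by (simp add: algebra_simps)
    then show ?thesis using pos x by (intro divide_right_mono mult_left_mono) auto
  qed
  also have "x * (3/8 * (x + w)\<^sup>2) / ((x - 1/2) * (x + w - 1/2) * (x + w))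
    = 3/8 * (x / (x - 1/2)) * ((x + w) / (x + w - 1/2))"
  proof -
    have "x * (3/8 * s\<^sup>2) / (P * R * s) = 3/8 * (x / P) * (s / R)" if "s \<noteq> 0" for P R s
      using that by (simp add: power2_eq_square)
    then show ?thesis using pos(3) by (metis less_irrefl)
  qed
  also have "\<dots> \<le> 3/8 * (a / (a - 1/2)) * (b / (b - 1/2))"
  proof -
    have ratio: "v / (v - 1/2) \<le> u / (u - 1/2)" if "1 \<le> u" "u \<le> v" for u v :: real
    proof -
      have "v * (u - 1/2) \<le> u * (v - 1/2)" using that by (simp add: algebra_simps)
      then have "v \<le> u * (v - 1/2) / (u - 1/2)" using that by (subst pos_le_divide_eq) auto
      then show ?thesis using that by (subst pos_divide_le_eq) auto
    qed
    have "x / (x - 1/2) \<le> a / (a - 1/2)"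
      by (rule ratio) (use assms in \<open>auto simp: x_def\<close>)
    moreover have "(x + w) / (x + w - 1/2) \<le> b / (b - 1/2)"
      by (rule ratio) (use assms in \<open>auto simp: x_def w_def\<close>)
    ultimately show ?thesis
      using pos(1,2) x assms(6) by (intro mult_mono mult_left_mono) (auto intro!: mult_nonneg_nonneg divide_nonneg_nonneg)
  qed
  finally have "serfling_factor M n \<le> x * w / (x + w) + 3/8 * (a / (a - 1/2)) * (b / (b - 1/2))"
    using main by linarith
  then show ?thesis unfolding nx by (simp only: x_def w_def)
qed

text \<open>
  In terms of \<open>D\<close>, the exponent \<open>2 q D\<^sup>2\<close> is the largest value of \<open>2 q y D - q y\<^sup>2 / 2\<close> over \<open>y\<close>;
  a finite grid of slopes \<open>y\<close> recovers it up to \<open>ln (\<theta> t / K)\<close>.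
\<close>
definition grid_cover :: "nat \<Rightarrow> (nat \<Rightarrow> real) \<Rightarrow> real \<Rightarrow> real \<Rightarrow> real \<Rightarrow> real \<Rightarrow> bool" where
  "grid_cover K y q B \<theta> t \<longleftrightarrow> 0 < K \<and> (\<forall>k<K. 0 < y k) \<and>
     (\<forall>D. 0 < D \<longrightarrow> D \<le> 1 \<longrightarrow> ln t < 2 * q * D\<^sup>2 \<longrightarrow>
       (\<exists>k<K. 2 * q * D\<^sup>2 - 2 * q * y k * D + B * (y k)\<^sup>2 / 2 \<le> ln (\<theta> * t / real K)))"

text \<open>A violation would put \<open>2 * q * D^2\<close> above \<open>ln t\<close>, because
  \<open>c \<ge> 0\<close> and \<open>\<delta> \<le> 1\<close>, so the cover supplies a slope. Its
  loss \<open>ln (\<theta> * t / K)\<close> and the penalty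
  \<open>ln (K / (\<theta> * \<delta>))\<close> add up to \<open>ln (t / \<delta>)\<close>, a
  contradiction.\<close>

lemma grid_cover_bound:
  assumes "grid_cover K y q B \<theta> t" and "0 < \<theta>" and "0 < t" and "0 < \<delta>" and "\<delta> \<le> 1" and "0 \<le> c"
    and "D \<le> 1" and "0 < D"
    and grid: "\<And>k. k < K \<Longrightarrow> 2 * q * y k * D - B * (y k)\<^sup>2 / 2 \<le> c + ln (real K / (\<theta> * \<delta>))"
  shows "2 * q * D\<^sup>2 \<le> c + ln (t / \<delta>)"
proof (rule ccontr)
  assume neg: "\<not> ?thesis"
  moreover have "ln t \<le> c + ln (t / \<delta>)"
    using assms(3-6) order_trans[of "ln \<delta>" 0 c] by (simp add: ln_div)
  ultimately obtain k where "k < K"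
    and "2 * q * D\<^sup>2 - 2 * q * y k * D + B * (y k)\<^sup>2 / 2 \<le> ln (\<theta> * t / real K)"
    using assms(1,7,8) unfolding grid_cover_def by (meson linorder_not_le order_le_less_trans)
  with grid[of k] have "2 * q * D\<^sup>2 \<le> c + (ln (real K / (\<theta> * \<delta>)) + ln (\<theta> * t / real K))" by simp
  also have "ln (real K / (\<theta> * \<delta>)) + ln (\<theta> * t / real K) = ln (t / \<delta>)"
    using assms(2-4) \<open>k < K\<close> by (simp add: ln_div ln_mult)
  finally show False using neg by simp
qed

text \<open>The odd multiples of \<open>1 / K\<close> below 2 come within \<open>1 / K\<close> of
  every \<open>2 * D\<close>, so the loss \<open>q / 2 * (2 * D - y)^2\<close> is at most
  \<open>q / (2 * K^2)\<close>. As slopes are at most 2, an excess \<open>\<epsilon>\<close> of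
  \<open>B\<close> over \<open>q\<close> costs at most \<open>2 * \<epsilon>\<close>.\<close>

lemma grid_cover_uniform:
  assumes "0 < K" and "0 \<le> \<epsilon>" and "B \<le> q + \<epsilon>" and "0 \<le> q"
    and le: "q / (2 * (real K)\<^sup>2) + 2 * \<epsilon> \<le> ln (\<theta> * t / real K)"
  shows "grid_cover K (\<lambda>k. (2 * real k + 1) / real K) q B \<theta> t"
  unfolding grid_cover_def
proof (intro conjI allI impI)
  fix D :: real assume D: "0 < D" "D \<le> 1"
  \<comment> \<open>The cell of \<open>D\<close> is open on the left and closed on the right, so
    that \<open>D = 1\<close> still falls into the last one, \<open>k = K - 1\<close>.\<close>
  define k where "k = nat (\<lceil>D * real K\<rceil> - 1)"
  have c: "0 < \<lceil>D * real K\<rceil>" using D \<open>0 < K\<close> by simp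
  have "D * real K \<le> real K" using D by (simp add: mult_left_le_one_le)
  then have "\<lceil>D * real K\<rceil> \<le> int K" by (simp add: ceiling_le_iff)
  then have "k < K" using c unfolding k_def by linarith
  have k: "real k < D * real K" "D * real K \<le> real k + 1"
    using c unfolding k_def by linarith+
  define y where "y = (2 * real k + 1) / real K"
  have yK: "y * real K = 2 * real k + 1" using \<open>0 < K\<close> by (simp add: y_def)
  have "\<bar>2 * D - y\<bar> * real K \<le> 1"
    unfolding abs_mult_pos' using k yK by (auto simp: abs_if algebra_simps)
  then have "\<bar>2 * D - y\<bar> \<le> 1 / real K" using \<open>0 < K\<close> by (simp add: field_simps)
  then have "(2 * D - y)\<^sup>2 \<le> (1 / real K)\<^sup>2" by (metis abs_ge_zero power2_abs power_mono)
  then have 1: "q / 2 * (2 * D - y)\<^sup>2 \<le> q / 2 * (1 / real K)\<^sup>2"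
    using \<open>0 \<le> q\<close> by (intro mult_left_mono) auto
  have "y * real K \<le> 2 * real K" using yK \<open>k < K\<close> by linarith
  then have "y \<le> 2" using \<open>0 < K\<close> by simp
  moreover have "0 \<le> y" by (simp add: y_def)
  ultimately have "y\<^sup>2 \<le> 2\<^sup>2" by (intro power_mono)
  then have "B * y\<^sup>2 / 2 - q * y\<^sup>2 / 2 \<le> 2 * \<epsilon>"
    using mult_right_mono[OF \<open>B \<le> q + \<epsilon>\<close>, of "y\<^sup>2"] mult_left_mono[of "y\<^sup>2" 4 \<epsilon>] \<open>0 \<le> \<epsilon>\<close> by (simp add: algebra_simps)
  moreover have "2 * q * D\<^sup>2 - 2 * q * y * D + q * y\<^sup>2 / 2 = q / 2 * (2 * D - y)\<^sup>2"
    by (simp add: power2_eq_square algebra_simps)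
  moreover have "q / 2 * (1 / real K)\<^sup>2 = q / (2 * (real K)\<^sup>2)" by (simp add: power_divide)
  ultimately have "2 * q * D\<^sup>2 - 2 * q * y * D + B * y\<^sup>2 / 2 \<le> ln (\<theta> * t / real K)"
    using 1 le by linarith
  then show "\<exists>k<K. 2 * q * D\<^sup>2 - 2 * q * ((2 * real k + 1) / real K) * D
      + B * ((2 * real k + 1) / real K)\<^sup>2 / 2 \<le> ln (\<theta> * t / real K)"
    using \<open>k < K\<close> unfolding y_def by blast
qed (use assms in auto)

text \<open>For \<open>B = q\<close> the loss is a convex parabola in \<open>D\<close>, and the
  slope 6/5 gives it the same value \<open>8/25 * q\<close> at \<open>D = 1/5\<close> and at
  \<open>D = 1\<close>. An excess \<open>\<epsilon>\<close> of \<open>B\<close> adds at most 18/25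
  of it, half the square of 6/5.\<close>

lemma grid_cover_single:
  assumes "0 \<le> \<epsilon>" and "B \<le> q + \<epsilon>" and "0 < q" and "0 < t"
    and le: "8/25 * q + 18/25 * \<epsilon> \<le> ln (47/50 * t)"
  shows "grid_cover 1 (\<lambda>_. 6/5) q B (47/50) t"
  unfolding grid_cover_def
proof (intro conjI allI impI exI[of _ 0])
  fix D :: real assume D: "0 < D" "D \<le> 1" "ln t < 2 * q * D\<^sup>2"
  \<comment> \<open>The threshold \<open>ln t\<close> confines attention to \<open>D > 2/5\<close>,
    inside the interval from 1/5 to 1 on which the parabola is controlled.\<close>
  have "ln (47/50 * t) \<le> ln t" using \<open>0 < t\<close> by (subst ln_le_cancel_iff) auto
  then have "8/25 * q < 2 * q * D\<^sup>2" using D le \<open>0 \<le> \<epsilon>\<close> by linarith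
  then have "(2/5)\<^sup>2 < D\<^sup>2" using \<open>0 < q\<close> by (simp add: power2_eq_square)
  then have "2/5 < D" by (rule power2_less_imp_less) (use D in auto)
  then have "0 \<le> 2 * q * ((1 - D) * (D - 1/5))" using D \<open>0 < q\<close> by simp
  moreover have "8/25 * q + 18/25 * \<epsilon> - (2 * q * D\<^sup>2 - 2 * q * (6/5) * D + 18/25 * (q + \<epsilon>)) = 2 * q * ((1 - D) * (D - 1/5))"
    by (simp add: power2_eq_square field_simps)
  ultimately have "2 * q * D\<^sup>2 - 2 * q * (6/5) * D + 18/25 * (q + \<epsilon>) \<le> 8/25 * q + 18/25 * \<epsilon>"
    by linarith
  then show "2 * q * D\<^sup>2 - 2 * q * (6/5) * D + B * (6/5)\<^sup>2 / 2 \<le> ln (47/50 * t / real 1)"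
  proof -
    have "B * (6/5)\<^sup>2 / 2 = 18/25 * B" by (simp add: power2_eq_square)
    moreover have "18/25 * B \<le> 18/25 * (q + \<epsilon>)" using \<open>B \<le> q + \<epsilon>\<close> by simp
    moreover have "ln (47/50 * t / real 1) = ln (47/50 * t)" by simp
    ultimately show ?thesis
      using le \<open>2 * q * D\<^sup>2 - 2 * q * (6/5) * D + 18/25 * (q + \<epsilon>) \<le> 8/25 * q + 18/25 * \<epsilon>\<close>
      by linarith
  qed
qed auto


text \<open>Any rational lower bound \<open>L\<close> for \<open>ln nL\<close> reduces the logarithm
  of the weighted threshold to a constant plus \<open>ln (sqrt q)\<close>; 141/50 is 3 times the
  weight 47/50.\<close>

lemma t_factor_ge:
  fixes L :: real
  assumes "2 \<le> nL" and "nL < n" and "q = real nL * real (n - nL) / real n"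
    and "0 < L" and "L \<le> ln (real nL)"
  shows "ln (141/50 * L) + ln (sqrt q) \<le> ln (47/50 * t_factor nL n)" and "0 < q" and "0 < t_factor nL n"
    and "3 * L * sqrt q \<le> t_factor nL n"
proof -
  have q: "real nL * (1 - real nL / real n) = q"
    using assms by (simp add: of_nat_diff field_simps)
  show "0 < q" using assms by simp
  show "3 * L * sqrt q \<le> t_factor nL n"
    unfolding t_factor_def q using \<open>0 < q\<close> assms by (intro mult_right_mono) auto
  moreover have "0 < 3 * L * sqrt q" using \<open>0 < L\<close> \<open>0 < q\<close> by simp
  ultimately show "0 < t_factor nL n" by linarith
  have "ln (141/50 * L) + ln (sqrt q) = ln (47/50 * (3 * L * sqrt q))"
    using \<open>0 < L\<close> \<open>0 < q\<close> ln_mult[of "141/50 * L" "sqrt q"] by (simp add: mult_ac)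
  also have "\<dots> \<le> ln (47/50 * t_factor nL n)"
    using \<open>3 * L * sqrt q \<le> t_factor nL n\<close> \<open>0 < 3 * L * sqrt q\<close> by (subst ln_le_cancel_iff) auto
  finally show "ln (141/50 * L) + ln (sqrt q) \<le> ln (47/50 * t_factor nL n)" .
qed

text \<open>For large \<open>q\<close> about \<open>sqrt q\<close> slopes are used: their number
  cancels the factor \<open>sqrt q\<close> of the threshold, and what remains exceeds the loss. For
  \<open>q < 6\<close> one slope suffices, which is checked numerically in ranges of
  \<open>nL\<close>, \<open>n\<close> and \<open>q\<close>.\<close>

lemma labeled_cover:
  assumes "2 \<le> nL" and "nL < n" and q_def: "q = real nL * real (n - nL) / real n"
  shows "\<exists>p \<in> {nL, n - nL}. \<exists>K y. grid_cover K y q (serfling_factor p n) (47/50) (t_factor nL n)"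
proof -
  define M where "M = max nL (n - nL)"
  define w where "w = min nL (n - nL)"
  have Mw: "1 \<le> w" "w \<le> M" "n = M + w" "M \<in> {nL, n - nL}" "real M * real w / real n = q"
    using assms by (auto simp: M_def w_def max_def min_def)
  note tq = t_factor_ge[OF assms(1,2) q_def]
  have lnL: "c \<le> ln (real nL)" if "c \<le> ln (real a)" "a \<le> nL" "0 < a" for a c
    using that by (meson ln_mono of_nat_0_less_iff of_nat_le_iff order_trans)
  have "q < real nL"
    using assms by (simp add: q_def field_simps of_nat_diff)
  have ln2: "9/13 \<le> ln (2::real)" using ln_ge_ratio[of 9 1 13 2] by simp
  have l2: "ln (real nL) \<ge> 9/13" by (rule lnL[of _ 2]) (use ln2 assms in auto)
  have "0 < (9/13 :: real)" by simp
  note tq2 = tq[OF this l2]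
  show ?thesis
  proof (cases "6 \<le> q")
    case True
    define K where "K = nat \<lceil>sqrt q\<rceil>"
    have s: "12/5 \<le> sqrt q" using True by (intro real_le_rsqrt) (simp add: power2_eq_square)
    then have K: "sqrt q \<le> real K" "real K \<le> sqrt q + 1" unfolding K_def by linarith+
    then have "0 < K" using s by linarith
    \<comment> \<open>The arithmetic-geometric mean inequality gives \<open>4 * q \<le> n\<close>,
      so \<open>q \<ge> 6\<close> forces \<open>n \<ge> 24\<close> and \<open>M \<ge> 12\<close>,
      which pushes the excess below 2/5.\<close>
    have "4 * (real M * real w) \<le> (real n)\<^sup>2"
      using sum_squares_ge_zero[of "real M - real w" 0] Mw(3) by (simp add: power2_eq_square algebra_simps)
    then have "4 * q \<le> real n"
      unfolding Mw(5)[symmetric] using assms by (simp add: field_simps power2_eq_square)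
    then have n: "24 \<le> n" using True by linarith
    have e: "serfling_factor M n \<le> q + 2/5"
      using serfling_factor_excess[of w M n 12 24] Mw n by simp
    have "7 \<le> nL" using True \<open>q < real nL\<close> by linarith
    moreover have "19/10 \<le> ln (7::real)" using ln_ge_ratio[of 19 1 10 7] by simp
    ultimately have l7: "19/10 \<le> ln (real nL)" by (intro lnL[of _ 7]) auto
    have 1: "q / (2 * (real K)\<^sup>2) \<le> 1/2"
      using power_mono[OF K(1), of 2] tq2(2) \<open>0 < K\<close> by (subst pos_divide_le_eq) auto
    \<comment> \<open>The loss to be covered is 1/2 + 2 * 2/5 = 13/10, and 1858/500 is a lower bound
      for the weighted threshold per slope.\<close>
    have 2: "(13/10::real) \<le> ln (1858/500)"
      using ln_ge_ratio[of 13 500 10 1858] by simp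
    have 3: "ln (1858/500) \<le> ln (47/50 * t_factor nL n / real K)"
    proof -
      have "1858/500 * real K \<le> 1858/500 * (sqrt q + 1)" using K by simp
      also have "\<dots> \<le> 47/50 * (3 * (19/10) * sqrt q)" using s by simp
      also have "\<dots> \<le> 47/50 * t_factor nL n" using tq(4)[OF _ l7] by simp
      finally show ?thesis using \<open>0 < K\<close> by (subst ln_le_cancel_iff) (auto simp: field_simps)
    qed
    have "q / (2 * (real K)\<^sup>2) + 2 * (2/5) \<le> ln (47/50 * t_factor nL n / real K)"
      using 1 2 3 by linarith
    then have "grid_cover K (\<lambda>k. (2 * real k + 1) / real K) q (serfling_factor M n) (47/50) (t_factor nL n)"
      using \<open>0 < K\<close> e tq2(2) by (intro grid_cover_uniform[where \<epsilon> = "2/5"]) linarith+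
    then show ?thesis using Mw by blast
  next
    case q6: False
    have single: ?thesis if "0 \<le> \<epsilon>" "p \<in> {nL, n - nL}" "serfling_factor p n \<le> q + \<epsilon>"
      "8/25 * q + 18/25 * \<epsilon> \<le> ln (47/50 * t_factor nL n)" for \<epsilon> p
      by (intro bexI[OF _ that(2)] exI) (rule grid_cover_single[OF that(1,3) tq2(2,3) that(4)])
    show ?thesis
    proof (cases "nL = 2")
      case nL: True
      have "2/3 \<le> ln (1949/1000 :: real)" using ln_ge_ratio[of 2 1000 3 1949] by simp
      also have "\<dots> \<le> ln (141/50 * (9/13))" by simp
      finally have c: "2/3 + ln (sqrt q) \<le> ln (47/50 * t_factor nL n)" using tq2(1) by simp
      \<comment> \<open>For 3 and 4 tasks there is little room, so the exact Serfling factors 1 =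
        2/3 + 1/3 and 13/9 = 1 + 4/9 replace the general excess bound.\<close>
      consider "n = 3" | "n = 4" | "5 \<le> n" using assms nL by linarith
      then show ?thesis
      proof cases
        case 1
        have q: "q = 2/3" using 1 nL q_def by simp
        have "- (5/24) \<le> ln (sqrt q)"
          unfolding q using ln_inverse_approx_le[of 1 "1/2"] by (simp add: ln_sqrt ln_div)
        moreover have "{2..<3::nat} = {2}" by auto
        ultimately show ?thesis
          using c q 1 nL by (intro single[of "1/3" 2]) (auto simp: serfling_factor_def)
      next
        case 2
        have q: "q = 1" using 2 nL q_def by simp
        have "{2..<4::nat} = {2, 3}" by auto
        then show ?thesis
          using c q 2 nL by (intro single[of "4/9" 2]) (auto simp: serfling_factor_def)
      next
        case 3
        have q: "q = 2 - 4 / real n" using 3 nL q_def by (simp add: field_simps of_nat_diff)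
        moreover have "4 / real n \<le> 4/5" using 3 by (simp add: field_simps)
        moreover have "0 < 4 / real n" using 3 by simp
        ultimately have qb: "6/5 \<le> q" "q \<le> 2" by linarith+
        have "3 \<le> M" using 3 nL by (simp add: M_def)
        then have e: "serfling_factor M n \<le> q + 1/2"
          using serfling_factor_excess[of w M n 3 5] Mw 3 by simp
        \<comment> \<open>After clearing the denominator \<open>q + 1\<close>, the next inequality
          is a multiple of this one: 13/12 and 2 are the roots of the resulting quadratic.\<close>
        have "0 \<le> (q - 13/12) * (2 - q)" using qb by simp
        then have "8/25 * q + 9/25 \<le> 2/3 + (q - 1) / (q + 1)"
          using qb by (simp add: field_simps)
        also have "\<dots> \<le> 2/3 + ln (sqrt q)" using half_ln_ge[of q] qb by simp
        finally show ?thesis using c e Mw by (intro single[of "1/2" M]) auto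
      qed
    next
      case False
      then have "3 \<le> nL" "4 \<le> n" "3 \<le> M" using assms by (auto simp: M_def)
      have e: "serfling_factor M n \<le> q + 13/25"
        using serfling_factor_excess[of w M n 3 4] Mw \<open>3 \<le> M\<close> \<open>4 \<le> n\<close> by simp
      have L3: "23/21 \<le> ln (real nL)"
        by (rule lnL[of _ 3]) (use ln_ge_ratio[of 23 1 21 3] \<open>3 \<le> nL\<close> in auto)
      have "9/8 \<le> ln (386/125 :: real)" using ln_ge_ratio[of 9 125 8 386] by simp
      also have "\<dots> \<le> ln (141/50 * (23/21))" by simp
      finally have c: "9/8 + ln (sqrt q) \<le> ln (47/50 * t_factor nL n)" using tq(1)[OF _ L3] by simp
      have "8/25 * q + 18/25 * (13/25) \<le> ln (47/50 * t_factor nL n)"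
      proof -
        \<comment> \<open>Each range has its own bound for \<open>ln (sqrt q)\<close>: from
          \<open>1 - 1 / q\<close> below 1, from \<open>half_ln_ge\<close> up to 4, and a constant
          beyond. Since \<open>q < nL\<close>, a larger \<open>q\<close> also improves the bound for
          \<open>ln nL\<close>.\<close>
        consider "q < 1" | "1 \<le> q" "q \<le> 4" | "4 < q" "q < 5" | "5 \<le> q" by linarith
        then show ?thesis
        proof cases
          case 1
          have "real n \<le> real nL * real (n - nL) + 1"
          proof -
            have "0 \<le> (real nL - 1) * (real (n - nL) - 1)" using assms by (intro mult_nonneg_nonneg) auto
            then show ?thesis using assms by (simp add: algebra_simps of_nat_diff)
          qed
          then have "(real n - 1) / real n \<le> q" unfolding q_def by (intro divide_right_mono) auto
          then have "1 - 1 / real n \<le> q" using \<open>4 \<le> n\<close> by (simp add: diff_divide_distrib)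
          moreover have "1 / real n \<le> 1/4" using \<open>4 \<le> n\<close> by (simp add: field_simps)
          ultimately have "3/4 \<le> q" by linarith
          then have "1 / q \<le> 4/3" by (simp add: field_simps)
          moreover have "1 - 1 / q \<le> ln q"
            using ln_le_minus_one[of "1 / q"] tq2(2) by (simp add: ln_div)
          ultimately have "- (1/6) \<le> ln (sqrt q)" using tq2(2) by (simp add: ln_sqrt)
          then show ?thesis using c 1 by simp
        next
          case 2
          have "0 \<le> (q - 1) * (4 - q)" using 2 by simp
          then have "8/25 * q + 18/25 * (13/25) \<le> 9/8 + (q - 1) / (q + 1)"
            using 2 by (simp add: field_simps)
          then show ?thesis using c half_ln_ge[of q] 2 by linarith
        next
          case 3
          then have "5 \<le> nL" using \<open>q < real nL\<close> by linarith
          have L: "8/5 \<le> ln (real nL)"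
            by (rule lnL[of _ 5]) (use ln_ge_ratio[of 8 1 5 5] \<open>5 \<le> nL\<close> in auto)
          have "3/2 \<le> ln (9/2 :: real)" using ln_ge_ratio[of 3 2 2 9] by simp
          also have "\<dots> \<le> ln (141/50 * (8/5))" by simp
          finally have "3/2 + ln (sqrt q) \<le> ln (47/50 * t_factor nL n)" using tq(1)[OF _ L] by simp
          moreover have "ln 2 \<le> ln (sqrt q)"
            using 3 by (subst ln_le_cancel_iff) (auto intro!: real_le_rsqrt)
          ultimately show ?thesis using ln2 3 by linarith
        next
          case 4
          then have "6 \<le> nL" using \<open>q < real nL\<close> by linarith
          have L: "7/4 \<le> ln (real nL)"
            by (rule lnL[of _ 6]) (use ln_ge_ratio[of 7 1 4 6] \<open>6 \<le> nL\<close> in auto)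
          have "11/7 \<le> ln (49/10 :: real)" using ln_ge_ratio[of 11 10 7 49] by simp
          also have "\<dots> \<le> ln (141/50 * (7/4))" by simp
          finally have "11/7 + ln (sqrt q) \<le> ln (47/50 * t_factor nL n)" using tq(1)[OF _ L] by simp
          moreover have "4/5 \<le> ln (223/100 :: real)" using ln_ge_ratio[of 4 100 5 223] by simp
          moreover have "223/100 \<le> sqrt q"
            using 4 by (intro real_le_rsqrt) (simp add: power2_eq_square)
          then have "ln (223/100) \<le> ln (sqrt q)"
            by (subst ln_le_cancel_iff) linarith+
          ultimately show ?thesis using q6 by linarith
        qed
      qed
      then show ?thesis using e Mw by (intro single[of "13/25" M]) auto
    qed
  qed
qed

section \<open>Sampling without replacement\<close>

text \<open>Negative \<open>l\<close> is reduced to positive \<open>- l\<close> by passing to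
  \<open>- f\<close>, whose values lie in an interval of the same length.\<close>

lemma (in prob_space) hoeffding_lemma_unit_interval:
  fixes f :: "'a \<Rightarrow> real"
  assumes [measurable]: "f \<in> borel_measurable M" and range: "\<And>x. x \<in> space M \<Longrightarrow> f x \<in> {0..1}"
  shows "(\<integral>\<^sup>+x. ennreal (exp (l * (f x - expectation f))) \<partial>M) \<le> ennreal (exp (l\<^sup>2 / 8))"
proof -
  consider "l = 0" | "0 < l" | "l < 0" by linarith
  then show ?thesis
  proof cases
    case 1
    then show ?thesis by (simp add: emeasure_space_1)
  next
    case 2
    interpret interval_bounded_random_variable M f 0 1
      by unfold_locales (use range in auto)
    show ?thesis using Hoeffdings_lemma_nn_integral[OF 2] by simp
  next
    case 3
    interpret interval_bounded_random_variable M "\<lambda>x. - f x" "-1" 0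
      by unfold_locales (use range in force)+
    have "(\<integral>\<^sup>+x. ennreal (exp (- l * (- f x - expectation (\<lambda>x. - f x)))) \<partial>M) \<le> ennreal (exp (l\<^sup>2 / 8))"
      using Hoeffdings_lemma_nn_integral[of "- l"] 3 by simp
    then show ?thesis by (simp add: algebra_simps)
  qed
qed

lemma sum_exp_centered_le:
  fixes g :: "'a \<Rightarrow> real"
  assumes "finite U" and "U \<noteq> {}" and range: "\<And>x. x \<in> U \<Longrightarrow> g x \<in> {0..1}"
  shows "(\<Sum>x\<in>U. exp (l * (g x - sum g U / real (card U)))) \<le> real (card U) * exp (l\<^sup>2 / 8)"
proof -
  \<comment> \<open>The range condition is imposed on the whole type, so \<open>g\<close> is
    continued by 0 outside the support of the uniform distribution.\<close>
  define h where "h x = (if x \<in> U then g x else 0)" for x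
  have "card U > 0" using assms by (simp add: card_gt_0_iff)
  have e: "measure_pmf.expectation (pmf_of_set U) h = sum g U / real (card U)"
    using assms by (simp add: integral_pmf_of_set h_def)
  have "(\<integral>\<^sup>+x. ennreal (exp (l * (h x - measure_pmf.expectation (pmf_of_set U) h))) \<partial>measure_pmf (pmf_of_set U))
    \<le> ennreal (exp (l\<^sup>2 / 8))"
    by (rule measure_pmf.hoeffding_lemma_unit_interval) (use range in \<open>auto simp: h_def\<close>)
  moreover have "(\<integral>\<^sup>+x. ennreal (exp (l * (h x - sum g U / real (card U)))) \<partial>measure_pmf (pmf_of_set U))
    = ennreal ((\<Sum>x\<in>U. exp (l * (g x - sum g U / real (card U)))) / real (card U))"
    using assms \<open>card U > 0\<close>
    by (simp add: nn_integral_pmf_of_set h_def sum_ennreal divide_ennreal sum_nonneg ennreal_of_nat_eq_real_of_nat)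
  ultimately show ?thesis
    using \<open>card U > 0\<close> by (simp add: e field_simps)
qed

text \<open>Double counting of the pairs of a subset and one of its elements. Probabilistically:
  drawing a sample is drawing \<open>x\<close> first and then the rest from the population without
  \<open>x\<close>.\<close>

lemma sum_subsets_card_Suc:
  fixes F :: "'a set \<Rightarrow> real"
  assumes "finite U"
  shows "real (Suc k) * (\<Sum>I | I \<subseteq> U \<and> card I = Suc k. F I)
    = (\<Sum>x\<in>U. \<Sum>J | J \<subseteq> U - {x} \<and> card J = k. F (insert x J))"
proof -
  let ?A = "{I. I \<subseteq> U \<and> card I = Suc k}"
  have fin: "finite ?A" using assms by simp
  have "real (Suc k) * (\<Sum>I\<in>?A. F I) = (\<Sum>I\<in>?A. \<Sum>x\<in>I. F I)"
    by (simp add: sum_distrib_left)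
  also have "\<dots> = (\<Sum>I\<in>?A. \<Sum>x\<in>U. if x \<in> I then F I else 0)"
  proof (rule sum.cong[OF refl])
    fix I assume "I \<in> ?A"
    then have "U \<inter> I = I" by auto
    then show "(\<Sum>x\<in>I. F I) = (\<Sum>x\<in>U. if x \<in> I then F I else 0)"
      using sum.inter_restrict[OF assms, of "\<lambda>_. F I" I] by simp
  qed
  also have "\<dots> = (\<Sum>x\<in>U. \<Sum>I\<in>?A. if x \<in> I then F I else 0)"
    by (rule sum.swap)
  also have "\<dots> = (\<Sum>x\<in>U. \<Sum>J | J \<subseteq> U - {x} \<and> card J = k. F (insert x J))"
  proof (rule sum.cong[OF refl])
    fix x assume "x \<in> U"
    have "(\<Sum>I\<in>?A. if x \<in> I then F I else 0) = (\<Sum>I\<in>{I\<in>?A. x \<in> I}. F I)"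
      using fin by (simp add: sum.If_cases Int_def)
    also have "\<dots> = (\<Sum>J | J \<subseteq> U - {x} \<and> card J = k. F (insert x J))"
    proof (rule sum.reindex_bij_witness[where i = "insert x" and j = "\<lambda>I. I - {x}"])
      fix J assume J: "J \<in> {J. J \<subseteq> U - {x} \<and> card J = k}"
      then have "finite J" "x \<notin> J" using assms by (auto dest: finite_subset)
      then show "insert x J \<in> {I \<in> ?A. x \<in> I}" "insert x J - {x} = J"
        using J \<open>x \<in> U\<close> by auto
    qed (use assms in \<open>auto simp: insert_absorb\<close>)
    finally show "(\<Sum>I\<in>?A. if x \<in> I then F I else 0) = (\<Sum>J | J \<subseteq> U - {x} \<and> card J = k. F (insert x J))" .
  qed
  finally show ?thesis .
qed

text \<open>
  Drawing one element \<open>x\<close> first, the centred sum of the sample splits into the contribution of \<open>x\<close>,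
  damped by \<open>(n - k) / (n - 1)\<close>, and the centred sum of the rest of the sample in the population
  without \<open>x\<close>.
\<close>
lemma serfling_mgf:
  fixes g :: "'a \<Rightarrow> real"
  assumes "finite U" and "card U = n" and "k < n" and "\<And>x. x \<in> U \<Longrightarrow> g x \<in> {0..1}"
  shows "(\<Sum>I | I \<subseteq> U \<and> card I = k. exp (s * (\<Sum>i\<in>I. g i - sum g U / real n)))
    \<le> real (n choose k) * exp (s\<^sup>2 / 8 * ((real (n - k))\<^sup>2 * (\<Sum>j=n-k..<n. 1 / (real j)\<^sup>2)))"
  using assms
proof (induction k arbitrary: U n)
  case 0
  have "{I. I \<subseteq> U \<and> card I = 0} = {{}}"
    using \<open>finite U\<close> by (auto dest: finite_subset)
  then show ?case by simp
next
  case (Suc k)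
  define r where "r = n - Suc k"
  define \<mu> where "\<mu> = sum g U / real n"
  obtain n' where n': "n = Suc n'" using Suc.prems by (cases n) auto
  have r: "0 < r" "r = n' - k" "k < n'" "real r = real n' - real k"
    using Suc.prems n' by (auto simp: r_def of_nat_diff)
  have n0: "0 < real n'" using r by simp
  define E' where "E' = exp (s\<^sup>2 / 8 * ((real r)\<^sup>2 * (\<Sum>j=r..<n'. 1 / (real j)\<^sup>2)))"
  define l where "l = s * (real r / real n')"
  have split: "(\<Sum>J | J \<subseteq> U - {x} \<and> card J = k. exp (s * (\<Sum>i\<in>insert x J. g i - \<mu>)))
    \<le> exp (l * (g x - \<mu>)) * (real (n' choose k) * E')" if x: "x \<in> U" for x
  proof -
    define \<mu>' where "\<mu>' = sum g (U - {x}) / real n'"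
    have "sum g U = g x + sum g (U - {x})" using Suc.prems(1) x by (simp add: sum.remove)
    then have "real n * \<mu> = g x + real n' * \<mu>'" using n' r by (simp add: \<mu>_def \<mu>'_def)
    then have "real n' * (\<mu>' - \<mu>) = \<mu> - g x" by (simp add: n' algebra_simps)
    then have mm: "\<mu>' - \<mu> = (\<mu> - g x) / real n'" using n0 by (simp add: field_simps)
    \<comment> \<open>Recentring the other \<open>k\<close> elements from \<open>\<mu>\<close> to
      \<open>\<mu>'\<close> costs \<open>k * (\<mu> - g x) / n'\<close>, which leaves
      \<open>g x - \<mu>\<close> with the factor \<open>1 - k / n' = r / n'\<close>.\<close>
    have "(\<Sum>i\<in>insert x J. g i - \<mu>) = (g x - \<mu>) * (real r / real n') + (\<Sum>i\<in>J. g i - \<mu>')"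
      if J: "J \<subseteq> U - {x}" "card J = k" for J
    proof -
      have "finite J" "x \<notin> J" using J Suc.prems(1) by (auto dest: finite_subset)
      then have "(\<Sum>i\<in>insert x J. g i - \<mu>) = (g x - \<mu>) + (\<Sum>i\<in>J. (g i - \<mu>') + (\<mu>' - \<mu>))" by simp
      also have "\<dots> = (g x - \<mu>) + (\<Sum>i\<in>J. g i - \<mu>') + real k * ((\<mu> - g x) / real n')"
        unfolding sum.distrib by (simp add: J mm)
      also have "(g x - \<mu>) + (\<Sum>i\<in>J. g i - \<mu>') + real k * ((\<mu> - g x) / real n')
          = (g x - \<mu>) * (real r / real n') + (\<Sum>i\<in>J. g i - \<mu>')"
        using n0 by (simp add: r(4) field_simps)
      finally show ?thesis .
    qed
    then have "(\<Sum>J | J \<subseteq> U - {x} \<and> card J = k. exp (s * (\<Sum>i\<in>insert x J. g i - \<mu>)))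
      = (\<Sum>J | J \<subseteq> U - {x} \<and> card J = k. exp (l * (g x - \<mu>)) * exp (s * (\<Sum>i\<in>J. g i - \<mu>')))"
      by (intro sum.cong refl) (simp add: exp_add[symmetric] l_def algebra_simps)
    also have "\<dots> = exp (l * (g x - \<mu>)) * (\<Sum>J | J \<subseteq> U - {x} \<and> card J = k. exp (s * (\<Sum>i\<in>J. g i - \<mu>')))"
      by (simp add: sum_distrib_left)
    also have "\<dots> \<le> exp (l * (g x - \<mu>)) * (real (n' choose k) * E')"
      using Suc.IH[of "U - {x}" n'] Suc.prems x n' r unfolding E'_def \<mu>'_def r(2)
      by (intro mult_left_mono) auto
    finally show ?thesis .
  qed
  have "real (Suc k) * (\<Sum>I | I \<subseteq> U \<and> card I = Suc k. exp (s * (\<Sum>i\<in>I. g i - \<mu>)))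
    \<le> (\<Sum>x\<in>U. exp (l * (g x - \<mu>)) * (real (n' choose k) * E'))"
    unfolding sum_subsets_card_Suc[OF Suc.prems(1)] by (intro sum_mono split)
  also have "\<dots> = (\<Sum>x\<in>U. exp (l * (g x - sum g U / real (card U)))) * (real (n' choose k) * E')"
    by (simp add: sum_distrib_right \<mu>_def Suc.prems(2))
  \<comment> \<open>Hoeffding's lemma for the uniform first draw. With
    \<open>l = s * (r / n')\<close> its exponent is the term \<open>j = n'\<close> that the larger
    population adds to the sum.\<close>
  also have "\<dots> \<le> (real (card U) * exp (l\<^sup>2 / 8)) * (real (n' choose k) * E')"
    using Suc.prems n' by (intro mult_right_mono sum_exp_centered_le) (auto simp: E'_def)
  also have "\<dots> = real (Suc k) * (real (n choose Suc k) * (exp (l\<^sup>2 / 8) * E'))"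
  proof -
    have "real (Suc k) * real (n choose Suc k) = real n * real (n' choose k)"
      unfolding n' of_nat_mult[symmetric] by (simp only: Suc_times_binomial)
    then show ?thesis by (simp add: Suc.prems(2) del: of_nat_Suc)
  qed
  also have "exp (l\<^sup>2 / 8) * E' = exp (s\<^sup>2 / 8 * ((real r)\<^sup>2 * (\<Sum>j=r..<n. 1 / (real j)\<^sup>2)))"
  proof -
    have "(\<Sum>j=r..<n. 1 / (real j)\<^sup>2) = (\<Sum>j=r..<n'. 1 / (real j)\<^sup>2) + 1 / (real n')\<^sup>2"
      using r(2) by (simp add: n')
    then have "l\<^sup>2 / 8 + s\<^sup>2 / 8 * ((real r)\<^sup>2 * (\<Sum>j=r..<n'. 1 / (real j)\<^sup>2))
        = s\<^sup>2 / 8 * ((real r)\<^sup>2 * (\<Sum>j=r..<n. 1 / (real j)\<^sup>2))"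
      by (simp add: l_def power_mult_distrib power_divide ring_distribs)
    then show ?thesis by (simp add: E'_def exp_add[symmetric])
  qed
  finally show ?case
    unfolding r_def \<mu>_def by (simp del: of_nat_Suc)
qed

section \<open>The variational inequality\<close>

text \<open>
  The Gibbs variational inequality: with \<open>h\<close> the density of \<open>Q\<close> with respect to \<open>P\<close>, it is the
  \<open>Q\<close>-integral of \<open>1 + u \<le> exp u\<close> at \<open>u = g - ln Z - ln h\<close>, \<open>Z\<close> being the \<open>P\<close>-integral of \<open>exp g\<close>.
\<close>
lemma KL_variational:
  fixes g :: "'a \<Rightarrow> real"
  assumes "prob_space P" and "prob_space Q" and sets: "sets Q = sets P"
    and g[measurable]: "g \<in> borel_measurable P" and bdd: "\<And>x. x \<in> space P \<Longrightarrow> \<bar>g x\<bar> \<le> c"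
  shows "ennreal ((\<integral>x. g x \<partial>Q) - ln (\<integral>x. exp (g x) \<partial>P)) \<le> KL Q P"
proof (cases "absolutely_continuous P Q \<and> integrable Q (entropy_density (exp 1) P Q)")
  case True
  interpret P: prob_space P by fact
  interpret Q: prob_space Q by fact
  have space: "space Q = space P" using sets by (rule sets_eq_imp_space_eq)
  have gQ[measurable]: "g \<in> borel_measurable Q" using g by (simp add: measurable_cong_sets[OF sets refl])
  have ac: "absolutely_continuous P Q" and int: "integrable Q (entropy_density (exp 1) P Q)" using True by auto
  have "finite_measure Q" by unfold_locales
  from P.real_RN_deriv[OF this ac sets] obtain h
    where h[measurable]: "h \<in> borel_measurable P" and hRN: "AE x in P. RN_deriv P Q x = ennreal (h x)"
      and hpos: "AE x in Q. 0 < h x" and hnn: "\<And>x. 0 \<le> h x"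
    by this auto
  have "Q = density P (RN_deriv P Q)"
    using ac sets by (rule P.density_RN_deriv[symmetric])
  also have "\<dots> = density P h"
    using hRN by (auto intro!: density_cong)
  finally have Q: "Q = density P h" .
  have hQ[measurable]: "h \<in> borel_measurable Q" using h by (simp add: measurable_cong_sets[OF sets refl])
  have ed: "AE x in Q. entropy_density (exp 1) P Q x = ln (h x)"
    using absolutely_continuous_AE[OF sets ac hRN]
    by (auto simp: entropy_density_def hnn log_def)
  have edm: "entropy_density (exp 1) P Q \<in> borel_measurable Q"
    using measurable_entropy_density by (simp add: measurable_cong_sets[OF sets refl])
  have lnint: "integrable Q (\<lambda>x. ln (h x))"
    using integrable_cong_AE[OF edm _ ed] int by simp
  have KL: "KL Q P = ennreal (\<integral>x. ln (h x) \<partial>Q)"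
    using True integral_cong_AE[OF edm _ ed] by (simp add: KL_def KL_divergence_def)
  have gint: "integrable Q g"
    using bdd by (intro Q.integrable_const_bound[of _ c]) (auto simp: space)
  have "\<bar>exp (g x)\<bar> \<le> exp c" if "x \<in> space P" for x
    using bdd[OF that] by simp
  then have eint: "integrable P (\<lambda>x. exp (g x))"
    by (intro P.integrable_const_bound[of _ "exp c"]) auto
  define Z where "Z = (\<integral>x. exp (g x) \<partial>P)"
  have "exp (- c) \<le> Z"
  proof -
    have "exp (- c) \<le> exp (g x)" if "x \<in> space P" for x
      using bdd[OF that] by simp
    then have "(\<integral>x. exp (- c) \<partial>P) \<le> Z"
      unfolding Z_def using eint by (intro integral_mono) auto
    then show ?thesis by (simp add: P.prob_space)
  qed
  then have Z: "0 < Z" by (rule less_le_trans[rotated]) simp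
  have frac: "(\<integral>\<^sup>+x. ennreal (exp (g x) / h x) \<partial>Q) \<le> ennreal Z"
  proof -
    have "(\<integral>\<^sup>+x. ennreal (exp (g x) / h x) \<partial>Q) = (\<integral>\<^sup>+x. ennreal (h x) * ennreal (exp (g x) / h x) \<partial>P)"
      by (simp add: Q nn_integral_density)
    \<comment> \<open>Only an inequality: where \<open>h x = 0\<close>, the product on the left
      vanishes while \<open>exp (g x)\<close> does not.\<close>
    also have "\<dots> \<le> (\<integral>\<^sup>+x. ennreal (exp (g x)) \<partial>P)"
      by (intro nn_integral_mono) (auto simp: ennreal_mult[symmetric] hnn)
    also have "\<dots> = ennreal Z"
      unfolding Z_def using eint by (intro nn_integral_eq_integral) auto
    finally show ?thesis .
  qed
  have fint: "integrable Q (\<lambda>x. exp (g x) / h x)"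
    using frac by (intro integrableI_nonneg) (auto simp: hnn order_le_less_trans)
  have fle: "(\<integral>x. exp (g x) / h x \<partial>Q) \<le> Z"
    using frac fint Z by (subst (asm) nn_integral_eq_integral) (auto simp: hnn)
  define w where "w x = exp (g x) / h x" for x
  have wint: "integrable Q w" and wle: "(\<integral>x. w x \<partial>Q) \<le> Z"
    using fint fle by (auto simp: w_def[abs_def])
  have "(\<integral>x. g x - ln Z - ln (h x) \<partial>Q) \<le> (\<integral>x. w x / Z - 1 \<partial>Q)"
  proof (intro integral_mono_AE)
    show "AE x in Q. g x - ln Z - ln (h x) \<le> w x / Z - 1"
      using hpos
    proof eventually_elim
      fix x assume "0 < h x"
      then have "exp (g x - ln Z - ln (h x)) = w x / Z"
        using Z by (simp add: exp_diff w_def)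
      then show "g x - ln Z - ln (h x) \<le> w x / Z - 1"
        using exp_ge_add_one_self[of "g x - ln Z - ln (h x)"] by simp
    qed
  qed (use gint lnint wint in auto)
  also have "\<dots> = (\<integral>x. w x \<partial>Q) / Z - 1"
    using wint by (simp add: Q.prob_space)
  also have "\<dots> \<le> 0" using wle Z by simp
  finally have "(\<integral>x. g x \<partial>Q) - ln Z - (\<integral>x. ln (h x) \<partial>Q) \<le> 0"
    using gint lnint by (simp add: Q.prob_space)
  then show ?thesis unfolding KL Z_def by (intro ennreal_leI) simp
qed (auto simp: KL_def)

section \<open>Moment generating functions and Markov's inequality\<close>

text \<open>The mean over \<open>I\<close> is compared with the mean over its complement rather than
  over the population: this gap can fill the whole range from -1 to 1 that \<open>grid_cover\<close>
  handles, and it is antisymmetric between a sample and its complement.\<close>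

definition subset_gap :: "nat \<Rightarrow> (nat \<Rightarrow> real) \<Rightarrow> nat set \<Rightarrow> real" where
  "subset_gap n g I = (\<Sum>i\<in>{..<n} - I. g i) / real (n - card I) - (\<Sum>i\<in>I. g i) / real (card I)"

text \<open>The factor \<open>q\<close> cancels \<open>1 / k + 1 / (n - k)\<close>, so the exponent
  is \<open>- 2 * y\<close> times the centred sum over \<open>I\<close>, which is also
  \<open>2 * y\<close> times the one over the complement. Serfling's bound thus applies to either of
  the two samples, whence the choice of \<open>p\<close>.\<close>

lemma subset_gap_mgf:
  assumes "0 < k" and "k < n" and range: "\<And>i. i < n \<Longrightarrow> g i \<in> {0..1}"
    and q: "q = real k * real (n - k) / real n" and p: "p \<in> {k, n - k}"
  shows "(\<Sum>I | I \<subseteq> {..<n} \<and> card I = k. exp (2 * q * y * subset_gap n g I))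
    \<le> real (card {I. I \<subseteq> {..<n} \<and> card I = k}) * exp (serfling_factor p n * y\<^sup>2 / 2)"
proof -
  define \<mu> where "\<mu> = sum g {..<n} / real n"
  have card: "card {I. I \<subseteq> {..<n} \<and> card I = j} = n choose j" for j
    using n_subsets[of "{..<n}" j] by simp
  have compl: "(\<Sum>i\<in>{..<n} - I. g i - \<mu>) = - (\<Sum>i\<in>I. g i - \<mu>)" if "I \<subseteq> {..<n}" for I
  proof -
    have "(\<Sum>i<n. g i - \<mu>) = 0" using assms by (simp add: sum_subtractf \<mu>_def)
    then show ?thesis using that by (simp add: sum_diff)
  qed
  have gap: "2 * q * y * subset_gap n g I = - (2 * y) * (\<Sum>i\<in>I. g i - \<mu>)"
    if I: "I \<subseteq> {..<n}" "card I = k" for I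
  proof -
    define T where "T = (\<Sum>i\<in>I. g i - \<mu>)"
    have "finite I" using I(1) by (rule finite_subset) simp
    have "(\<Sum>i\<in>I. g i) = T + real k * \<mu>" by (simp add: T_def sum_subtractf I)
    moreover have "(\<Sum>i\<in>{..<n} - I. g i) = - T + real (n - k) * \<mu>"
      using compl[OF I(1), folded T_def] I \<open>finite I\<close> by (simp add: sum_subtractf card_Diff_subset)
    moreover have "(- T + c * \<mu>) / c = \<mu> - T / c" "(T + c * \<mu>) / c = \<mu> + T / c" if "0 < c" for c
      using that by (simp_all add: field_simps)
    ultimately have "subset_gap n g I = - (T / real (n - k)) - T / real k"
      using assms(1,2) by (simp add: subset_gap_def I del: of_nat_diff)
    also have "\<dots> = - T * (real n / (real k * real (n - k)))"
      using assms(1,2) by (simp add: of_nat_diff field_simps)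
    finally show ?thesis
      unfolding T_def[symmetric] using assms(1,2) by (simp add: q)
  qed
  from p consider "p = n - k" | "p = k" by auto
  then show ?thesis
  proof cases
    case 1
    have "(\<Sum>I | I \<subseteq> {..<n} \<and> card I = k. exp (2 * q * y * subset_gap n g I))
      = (\<Sum>I | I \<subseteq> {..<n} \<and> card I = k. exp (- (2 * y) * (\<Sum>i\<in>I. g i - \<mu>)))"
      by (intro sum.cong refl) (simp add: gap)
    then show ?thesis
      using serfling_mgf[of "{..<n}" n k g "- (2 * y)"] assms
      by (simp add: card 1 serfling_factor_def \<mu>_def mult_ac)
  next
    case 2
    have "(\<Sum>I | I \<subseteq> {..<n} \<and> card I = k. exp (2 * q * y * subset_gap n g I))
      = (\<Sum>J | J \<subseteq> {..<n} \<and> card J = n - k. exp (2 * y * (\<Sum>i\<in>J. g i - \<mu>)))"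
    proof (rule sum.reindex_bij_witness[where i = "\<lambda>J. {..<n} - J" and j = "\<lambda>I. {..<n} - I"])
      fix I assume I: "I \<in> {I. I \<subseteq> {..<n} \<and> card I = k}"
      then show "{..<n} - I \<in> {J. J \<subseteq> {..<n} \<and> card J = n - k}"
        by (auto simp: card_Diff_subset finite_subset)
      show "{..<n} - ({..<n} - I) = I" using I by auto
      show "exp (2 * y * (\<Sum>i\<in>{..<n} - I. g i - \<mu>)) = exp (2 * q * y * subset_gap n g I)"
        using I compl[of I] gap[of I] by simp
    next
      fix J assume J: "J \<in> {J. J \<subseteq> {..<n} \<and> card J = n - k}"
      then show "{..<n} - J \<in> {I. I \<subseteq> {..<n} \<and> card I = k}"
        using \<open>k < n\<close> by (auto simp: card_Diff_subset finite_subset)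
      show "{..<n} - ({..<n} - J) = J" using J by auto
    qed
    then show ?thesis
      using serfling_mgf[of "{..<n}" n "n - k" g "2 * y"] assms binomial_symmetric[of k n]
      by (simp add: card 2 serfling_factor_def \<mu>_def mult_ac)
  qed
qed

text \<open>By independence the exponential of the sum factorizes, and every factor is an instance
  of Hoeffding's lemma at \<open>- l\<close>.\<close>

lemma (in prob_space) iid_hoeffding_mgf:
  fixes f :: "'a \<Rightarrow> real"
  assumes [measurable]: "f \<in> borel_measurable M" and range: "\<And>x. x \<in> space M \<Longrightarrow> f x \<in> {0..1}"
    and "finite J"
  shows "(\<integral>\<^sup>+s. ennreal (exp (l * (\<Sum>j\<in>J. expectation f - f (s j)))) \<partial>Pi\<^sub>M J (\<lambda>_. M))
    \<le> ennreal (exp (real (card J) * l\<^sup>2 / 8))"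
proof -
  interpret P: product_prob_space "\<lambda>_. M" J by unfold_locales
  have "(\<integral>\<^sup>+s. ennreal (exp (l * (\<Sum>j\<in>J. expectation f - f (s j)))) \<partial>Pi\<^sub>M J (\<lambda>_. M))
    = (\<integral>\<^sup>+s. (\<Prod>j\<in>J. ennreal (exp (- l * (f (s j) - expectation f)))) \<partial>Pi\<^sub>M J (\<lambda>_. M))"
    by (simp add: prod_ennreal exp_sum[symmetric] \<open>finite J\<close> sum_distrib_left algebra_simps)
  also have "\<dots> = (\<Prod>j\<in>J. \<integral>\<^sup>+x. ennreal (exp (- l * (f x - expectation f))) \<partial>M)"
    using \<open>finite J\<close> by (intro P.product_nn_integral_prod) auto
  also have "\<dots> \<le> (\<Prod>j\<in>J. ennreal (exp (l\<^sup>2 / 8)))"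
  proof (intro prod_mono_ennreal)
    show "(\<integral>\<^sup>+x. ennreal (exp (- l * (f x - expectation f))) \<partial>M) \<le> ennreal (exp (l\<^sup>2 / 8))"
      using hoeffding_lemma_unit_interval[of f "- l"] range by simp
  qed
  also have "\<dots> = ennreal (exp (real (card J) * l\<^sup>2 / 8))"
    by (simp add: ennreal_power exp_of_nat_mult[symmetric])
  finally show ?thesis .
qed

text \<open>Markov's inequality is applied in \<open>S\<close> for each fixed \<open>I\<close>, and
  the failure probabilities are averaged over \<open>fam\<close>. Measurability is thus asked of
  each \<open>G I\<close> separately, and \<open>E\<close> is a finite union of rectangles.\<close>

lemma pmf_of_set_pair_markov:
  fixes G :: "'i \<Rightarrow> 's \<Rightarrow> ennreal"
  assumes "prob_space M" and fam: "finite fam" "fam \<noteq> {}"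
    and G[measurable]: "\<And>I. I \<in> fam \<Longrightarrow> G I \<in> borel_measurable M"
    and le: "(\<Sum>I\<in>fam. \<integral>\<^sup>+S. G I S \<partial>M) \<le> ennreal (real (card fam))" and "0 < \<delta>"
  shows "\<exists>E \<in> sets (measure_pmf (pmf_of_set fam) \<Otimes>\<^sub>M M).
    1 - \<delta> \<le> measure (measure_pmf (pmf_of_set fam) \<Otimes>\<^sub>M M) E \<and>
    (\<forall>(I, S) \<in> E. I \<in> fam \<and> S \<in> space M \<and> G I S \<le> ennreal (1 / \<delta>))"
proof -
  interpret M: prob_space M by fact
  interpret PM: pair_prob_space "measure_pmf (pmf_of_set fam)" M ..
  define good where "good I = {S \<in> space M. G I S \<le> ennreal (1 / \<delta>)}" for I
  define E where "E = (\<Union>I\<in>fam. {I} \<times> good I)"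
  have good[measurable]: "good I \<in> sets M" if "I \<in> fam" for I
    using that unfolding good_def by measurable
  have card: "0 < card fam" using fam by (simp add: card_gt_0_iff)
  have bad: "ennreal (1 - M.prob (good I)) \<le> ennreal \<delta> * (\<integral>\<^sup>+S. G I S \<partial>M)" if I: "I \<in> fam" for I
  proof -
    note [measurable] = G[OF I]
    have "ennreal (1 - M.prob (good I)) = emeasure M (space M - good I)"
      using good[OF I] by (simp add: M.prob_compl[symmetric] M.emeasure_eq_measure)
    also have "\<dots> \<le> emeasure M {S \<in> space M. 1 \<le> ennreal \<delta> * G I S}"
    proof (rule emeasure_mono)
      show "space M - good I \<subseteq> {S \<in> space M. 1 \<le> ennreal \<delta> * G I S}"
      proof
        fix S assume S: "S \<in> space M - good I"
        then have "ennreal (1 / \<delta>) \<le> G I S" by (auto simp: good_def)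
        then have "ennreal \<delta> * ennreal (1 / \<delta>) \<le> ennreal \<delta> * G I S" by (rule mult_left_mono) simp
        then show "S \<in> {S \<in> space M. 1 \<le> ennreal \<delta> * G I S}"
          using S \<open>0 < \<delta>\<close> by (simp add: ennreal_mult[symmetric])
      qed
    qed measurable
    also have "\<dots> \<le> ennreal \<delta> * (\<integral>\<^sup>+S. G I S * indicator (space M) S \<partial>M)"
      by (rule nn_integral_Markov_inequality) auto
    also have "(\<integral>\<^sup>+S. G I S * indicator (space M) S \<partial>M) = (\<integral>\<^sup>+S. G I S \<partial>M)"
      by (intro nn_integral_cong) auto
    finally show ?thesis .
  qed
  have "ennreal (\<Sum>I\<in>fam. 1 - M.prob (good I)) = (\<Sum>I\<in>fam. ennreal (1 - M.prob (good I)))"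
    by (simp add: sum_ennreal)
  also have "\<dots> \<le> (\<Sum>I\<in>fam. ennreal \<delta> * (\<integral>\<^sup>+S. G I S \<partial>M))"
    by (intro sum_mono bad)
  also have "\<dots> = ennreal \<delta> * (\<Sum>I\<in>fam. \<integral>\<^sup>+S. G I S \<partial>M)"
    by (simp add: sum_distrib_left)
  also have "\<dots> \<le> ennreal \<delta> * ennreal (real (card fam))"
    using le by (rule mult_left_mono) simp
  also have "\<dots> = ennreal (\<delta> * real (card fam))"
    using \<open>0 < \<delta>\<close> by (simp add: ennreal_mult)
  finally have sum: "(\<Sum>I\<in>fam. 1 - M.prob (good I)) \<le> \<delta> * real (card fam)"
    using \<open>0 < \<delta>\<close> by (subst (asm) ennreal_le_iff) auto
  have E: "E \<in> sets (measure_pmf (pmf_of_set fam) \<Otimes>\<^sub>M M)"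
    unfolding E_def using fam by (intro sets.finite_UN) auto
  have "PM.prob E = (\<Sum>I\<in>fam. PM.prob ({I} \<times> good I))"
    unfolding E_def using fam
    by (intro PM.finite_measure_finite_Union) (auto simp: disjoint_family_on_def)
  also have "\<dots> = (\<Sum>I\<in>fam. M.prob (good I) / real (card fam))"
  proof (rule sum.cong[OF refl])
    fix I assume I: "I \<in> fam"
    then have "emeasure (measure_pmf (pmf_of_set fam) \<Otimes>\<^sub>M M) ({I} \<times> good I)
      = ennreal (1 / real (card fam)) * ennreal (M.prob (good I))"
      using fam by (simp add: M.emeasure_pair_measure_Times emeasure_pmf_single M.emeasure_eq_measure)
    then show "PM.prob ({I} \<times> good I) = M.prob (good I) / real (card fam)"
      by (simp add: measure_def ennreal_mult[symmetric])
  qed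
  also have "\<dots> = 1 - (\<Sum>I\<in>fam. 1 - M.prob (good I)) / real (card fam)"
    using card by (simp add: sum_subtractf sum_divide_distrib diff_divide_distrib)
  also have "\<dots> \<ge> 1 - \<delta>"
    using sum card by (simp add: field_simps)
  finally show ?thesis
    using E by (intro bexI[of _ E]) (auto simp: E_def good_def)
qed

text \<open>Pushing \<open>L x\<close> forward along \<open>y \<mapsto> (x, y)\<close> removes the
  parameter from the integrand, so the map is a kernel followed by integration of one fixed
  function.\<close>

lemma integral_measurable_prob_algebra2:
  fixes f :: "'a \<Rightarrow> 'b \<Rightarrow> real"
  assumes f[measurable]: "(\<lambda>(x, y). f x y) \<in> borel_measurable (M \<Otimes>\<^sub>M N)"
    and L: "L \<in> M \<rightarrow>\<^sub>M prob_algebra N"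
  shows "(\<lambda>x. \<integral>y. f x y \<partial>L x) \<in> borel_measurable M"
proof -
  note L'[measurable] = measurable_prob_algebraD[OF L]
  note measurable_distr2[measurable]
  have "(\<lambda>x. integral\<^sup>L (distr (L x) (M \<Otimes>\<^sub>M N) (\<lambda>y. (x, y))) (\<lambda>(x, y). f x y)) \<in> borel_measurable M"
    by measurable
  then show ?thesis
  proof (rule measurable_cong[THEN iffD1, rotated])
    fix x assume x: "x \<in> space M"
    then have sets: "sets (L x) = sets N" using subprob_measurableD(2)[OF L'] by simp
    have "(\<lambda>y. (x, y)) \<in> L x \<rightarrow>\<^sub>M M \<Otimes>\<^sub>M N"
      using x by (simp add: measurable_cong_sets[OF sets refl])
    then show "integral\<^sup>L (distr (L x) (M \<Otimes>\<^sub>M N) (\<lambda>y. (x, y))) (\<lambda>(x, y). f x y) = (\<integral>y. f x y \<partial>L x)"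
      using integral_distr[OF _ f, of "\<lambda>y. (x, y)" "L x"] by simp
  qed
qed

section \<open>The multi-task setting\<close>

lemma ennreal_add_le: "ennreal (a + b) \<le> ennreal a + ennreal b"
proof -
  have "ennreal (a + b) \<le> ennreal (max 0 a + max 0 b)" by (intro ennreal_leI) simp
  also have "\<dots> = ennreal (max 0 a) + ennreal (max 0 b)" by (simp only: ennreal_plus[symmetric] max.cobounded1)
  finally show ?thesis by (simp add: ennreal_max_0)
qed

lemma ennreal_sum_le: "ennreal (sum f A) \<le> (\<Sum>i\<in>A. ennreal (f i))"
proof (induction A rule: infinite_finite_induct)
  case (insert x A)
  have "ennreal (f x + sum f A) \<le> ennreal (f x) + ennreal (sum f A)" by (rule ennreal_add_le)
  also have "\<dots> \<le> ennreal (f x) + (\<Sum>i\<in>A. ennreal (f i))" using insert by (intro add_left_mono)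
  finally show ?case using insert by simp
qed auto

text \<open>Positive parts dominate in the integrable case; otherwise the Bochner integral is 0 by
  convention. It serves to pass to lower integrals, where monotonicity needs no
  measurability.\<close>

lemma ennreal_integral_le_nn_integral: "ennreal (\<integral>x. f x \<partial>M) \<le> (\<integral>\<^sup>+x. ennreal (f x) \<partial>M)"
proof (cases "integrable M f")
  case True
  have "(\<integral>x. f x \<partial>M) \<le> (\<integral>x. max 0 (f x) \<partial>M)"
    using True by (intro integral_mono integrable_max) auto
  then have "ennreal (\<integral>x. f x \<partial>M) \<le> ennreal (\<integral>x. max 0 (f x) \<partial>M)" by (rule ennreal_leI)
  also have "\<dots> = (\<integral>\<^sup>+x. ennreal (max 0 (f x)) \<partial>M)"
    using True by (intro nn_integral_eq_integral[symmetric] integrable_max) auto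
  finally show ?thesis by (simp add: ennreal_max_0)
qed (simp add: not_integrable_integral_eq)

lemma (in prob_space) integral_bounds:
  fixes f :: "'a \<Rightarrow> real"
  assumes [measurable]: "f \<in> borel_measurable M" and range: "\<And>x. x \<in> space M \<Longrightarrow> f x \<in> {a..b}"
  shows "integrable M f" and "expectation f \<in> {a..b}"
proof -
  show i: "integrable M f"
  proof (rule integrable_const_bound[of _ "max \<bar>a\<bar> \<bar>b\<bar>"])
    show "AE x in M. norm (f x) \<le> max \<bar>a\<bar> \<bar>b\<bar>"
    proof (rule AE_I2)
      fix x assume "x \<in> space M"
      then show "norm (f x) \<le> max \<bar>a\<bar> \<bar>b\<bar>" using range[of x] by auto
    qed
  qed simp
  have "expectation (\<lambda>_. a) \<le> expectation f" "expectation f \<le> expectation (\<lambda>_. b)"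
    by (rule integral_mono; use range i in simp)+
  then show "expectation f \<in> {a..b}" by (simp add: prob_space)
qed

section \<open>Risks of models and posteriors, and their measurability\<close>

locale multi_task =
  fixes X :: "'x measure" and Y :: "'y measure"
    and \<F> :: "('x, 'y) model measure"
    and \<A> :: "('x, 'y) algorithm measure"
    and loss :: "'y \<Rightarrow> 'y \<Rightarrow> real"
    and D :: "nat \<Rightarrow> ('x \<times> 'y) measure"
    and n m :: nat
  assumes m: "1 \<le> m"
    and distributions: "\<And>i. i < n \<Longrightarrow> D i \<in> space (prob_algebra (X \<Otimes>\<^sub>M Y))"
    and models: "space \<F> \<subseteq> space X \<rightarrow> space Y"
    and loss_range: "\<And>y y'. y \<in> space Y \<Longrightarrow> y' \<in> space Y \<Longrightarrow> loss y y' \<in> {0..1}"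
    and loss_measurable:
      "(\<lambda>((x, y), f). loss y (f x)) \<in> borel_measurable ((X \<Otimes>\<^sub>M Y) \<Otimes>\<^sub>M \<F>)"
    and algorithms_measurable:
      "(\<lambda>(A, x). A (map x [0..<m])) \<in> \<A> \<Otimes>\<^sub>M (\<Pi>\<^sub>M j\<in>{..<m}. X) \<rightarrow>\<^sub>M prob_algebra \<F>"
begin

abbreviation dataset_space :: "(nat \<Rightarrow> 'x \<times> 'y) measure" where
  "dataset_space \<equiv> \<Pi>\<^sub>M j\<in>{..<m}. X \<Otimes>\<^sub>M Y"

definition model_emp :: "('x, 'y) model \<Rightarrow> (nat \<Rightarrow> 'x \<times> 'y) \<Rightarrow> real" where
  "model_emp f s = (\<Sum>j<m. loss (snd (s j)) (f (fst (s j)))) / real m"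

definition model_risk :: "nat \<Rightarrow> ('x, 'y) model \<Rightarrow> real" where
  "model_risk i f = (\<integral>z. loss (snd z) (f (fst z)) \<partial>D i)"

definition model_gap :: "nat \<Rightarrow> ('x, 'y) model \<Rightarrow> (nat \<Rightarrow> 'x \<times> 'y) \<Rightarrow> real" where
  "model_gap i f s = model_risk i f - model_emp f s"

definition task_emp :: "('x, 'y) algorithm \<Rightarrow> (nat \<Rightarrow> 'x \<times> 'y) \<Rightarrow> real" where
  "task_emp A s = (\<integral>f. model_emp f s \<partial>A (inputs m s))"

definition task_risk :: "nat \<Rightarrow> ('x, 'y) algorithm \<Rightarrow> (nat \<Rightarrow> 'x \<times> 'y) \<Rightarrow> real" where
  "task_risk i A s = (\<integral>f. model_risk i f \<partial>A (inputs m s))"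

lemma D_prob: "i < n \<Longrightarrow> prob_space (D i)" and D_sets: "i < n \<Longrightarrow> sets (D i) = sets (X \<Otimes>\<^sub>M Y)"
  using distributions by (auto simp: space_prob_algebra)

lemma D_space: "i < n \<Longrightarrow> space (D i) = space X \<times> space Y"
  using sets_eq_imp_space_eq[OF D_sets] by (simp add: space_pair_measure)

lemma dataset_sets: "i < n \<Longrightarrow> sets (\<Pi>\<^sub>M j\<in>{..<m}. D i) = sets dataset_space"
  by (intro sets_PiM_cong refl) (simp add: D_sets)

lemma loss_unit:
  assumes "z \<in> space X \<times> space Y" and "f \<in> space \<F>"
  shows "loss (snd z) (f (fst z)) \<in> {0..1}"
proof -
  have "f \<in> space X \<rightarrow> space Y" using assms models by blast
  then show ?thesis using assms by (intro loss_range) (auto simp: Pi_iff)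
qed

lemma loss_measurable': "(\<lambda>(z, f). loss (snd z) (f (fst z))) \<in> borel_measurable ((X \<Otimes>\<^sub>M Y) \<Otimes>\<^sub>M \<F>)"
  using loss_measurable by (simp add: split_beta')

lemma dataset_component: "s \<in> space dataset_space \<Longrightarrow> j < m \<Longrightarrow> s j \<in> space X \<times> space Y"
  by (auto simp: space_PiM space_pair_measure)

lemma model_emp_measurable: "(\<lambda>(s, f). model_emp f s) \<in> borel_measurable (dataset_space \<Otimes>\<^sub>M \<F>)"
proof -
  have "(\<lambda>(s, f). loss (snd (s j)) (f (fst (s j)))) \<in> borel_measurable (dataset_space \<Otimes>\<^sub>M \<F>)" if "j < m" for j
  proof -
    have "(\<lambda>w. (fst w j, snd w)) \<in> dataset_space \<Otimes>\<^sub>M \<F> \<rightarrow>\<^sub>M (X \<Otimes>\<^sub>M Y) \<Otimes>\<^sub>M \<F>"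
      using that by (intro measurable_Pair measurable_compose[OF measurable_fst measurable_component_singleton]) auto
    from measurable_compose[OF this loss_measurable'] show ?thesis by (simp add: split_beta')
  qed
  then show ?thesis
    unfolding model_emp_def split_beta' by (intro borel_measurable_divide borel_measurable_sum) auto
qed

lemma model_emp_range:
  assumes "s \<in> space dataset_space" and "f \<in> space \<F>"
  shows "model_emp f s \<in> {0..1}"
proof -
  have "loss (snd (s j)) (f (fst (s j))) \<in> {0..1}" if "j < m" for j
    using loss_unit[OF dataset_component] assms that by auto
  then have "0 \<le> (\<Sum>j<m. loss (snd (s j)) (f (fst (s j))))"
    "(\<Sum>j<m. loss (snd (s j)) (f (fst (s j)))) \<le> (\<Sum>j<m. 1)"
    by (intro sum_nonneg sum_mono; simp)+
  then show ?thesis using m by (simp add: model_emp_def)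
qed

lemma model_risk_measurable: "i < n \<Longrightarrow> model_risk i \<in> borel_measurable \<F>"
proof -
  assume i: "i < n"
  interpret prob_space "D i" by (rule D_prob[OF i])
  have "(\<lambda>(f, z). loss (snd z) (f (fst z))) \<in> borel_measurable (\<F> \<Otimes>\<^sub>M (X \<Otimes>\<^sub>M Y))"
    using measurable_compose[OF measurable_pair_swap' loss_measurable'] by (simp add: split_beta')
  then have "(\<lambda>(f, z). loss (snd z) (f (fst z))) \<in> borel_measurable (\<F> \<Otimes>\<^sub>M D i)"
    by (simp add: measurable_cong_sets[OF sets_pair_measure_cong[OF refl D_sets[OF i]] refl])
  then show ?thesis
    unfolding model_risk_def by (rule borel_measurable_lebesgue_integral)
qed

lemma model_loss_measurable:
  assumes "f \<in> space \<F>" and "i < n"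
  shows "(\<lambda>z. loss (snd z) (f (fst z))) \<in> borel_measurable (D i)"
proof -
  have "(\<lambda>z. (z, f)) \<in> X \<Otimes>\<^sub>M Y \<rightarrow>\<^sub>M (X \<Otimes>\<^sub>M Y) \<Otimes>\<^sub>M \<F>" using assms by simp
  from measurable_compose[OF this loss_measurable'] show ?thesis
    by (simp add: measurable_cong_sets[OF D_sets[OF assms(2)] refl])
qed

lemma model_risk_range: "i < n \<Longrightarrow> f \<in> space \<F> \<Longrightarrow> model_risk i f \<in> {0..1}"
  unfolding model_risk_def
  by (rule prob_space.integral_bounds(2)[OF D_prob]) (auto intro: model_loss_measurable simp only: D_space intro!: loss_unit)

lemma model_gap_measurable:
  assumes "i < n" shows "(\<lambda>(s, f). model_gap i f s) \<in> borel_measurable (dataset_space \<Otimes>\<^sub>M \<F>)"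
  unfolding model_gap_def split_beta'
  using model_emp_measurable measurable_compose[OF measurable_snd model_risk_measurable[OF assms]]
  by (intro borel_measurable_diff) (auto simp: split_beta')

lemma model_gap_range:
  "i < n \<Longrightarrow> s \<in> space dataset_space \<Longrightarrow> f \<in> space \<F> \<Longrightarrow> \<bar>model_gap i f s\<bar> \<le> 1"
  using model_emp_range[of s f] model_risk_range[of i f] by (auto simp: model_gap_def)

lemma kernel: "(\<lambda>(A, s). A (inputs m s)) \<in> \<A> \<Otimes>\<^sub>M dataset_space \<rightarrow>\<^sub>M prob_algebra \<F>"
proof -
  \<comment> \<open>Restriction to \<open>{..<m}\<close> makes the inputs a point of the product
    space; the list \<open>inputs m s\<close> reads only these coordinates.\<close>
  have "(\<lambda>w. (fst w, \<lambda>j\<in>{..<m}. fst (snd w j))) \<in> \<A> \<Otimes>\<^sub>M dataset_space \<rightarrow>\<^sub>M \<A> \<Otimes>\<^sub>M (\<Pi>\<^sub>M j\<in>{..<m}. X)"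
  proof (intro measurable_Pair measurable_fst measurable_restrict)
    fix j assume "j \<in> {..<m}"
    then have "(\<lambda>s. s j) \<in> dataset_space \<rightarrow>\<^sub>M X \<Otimes>\<^sub>M Y" by (rule measurable_component_singleton)
    from measurable_compose[OF measurable_compose[OF measurable_snd this] measurable_fst]
    show "(\<lambda>w. fst (snd w j)) \<in> \<A> \<Otimes>\<^sub>M dataset_space \<rightarrow>\<^sub>M X" .
  qed
  from measurable_compose[OF this algorithms_measurable]
  have "(\<lambda>w. (fst w) (map (\<lambda>j\<in>{..<m}. fst (snd w j)) [0..<m])) \<in> \<A> \<Otimes>\<^sub>M dataset_space \<rightarrow>\<^sub>M prob_algebra \<F>"
    by (simp add: split_beta')
  moreover have "map (\<lambda>j\<in>{..<m}. fst (s j)) [0..<m] = inputs m s" for s :: "nat \<Rightarrow> 'x \<times> 'y"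
    by (simp add: inputs_def)
  ultimately show ?thesis by (simp add: split_beta')
qed

lemma posterior: "A \<in> space \<A> \<Longrightarrow> s \<in> space dataset_space \<Longrightarrow> A (inputs m s) \<in> space (prob_algebra \<F>)"
  using measurable_space[OF kernel, of "(A, s)"] by (simp add: space_pair_measure)

lemma prob_algebra_facts:
  assumes "P \<in> space (prob_algebra M)"
  shows "prob_space P" and "sets P = sets M" and "space P = space M"
  using assms by (auto simp: space_prob_algebra dest: sets_eq_imp_space_eq)

lemma model_emp_measurable1: "s \<in> space dataset_space \<Longrightarrow> (\<lambda>f. model_emp f s) \<in> borel_measurable \<F>"
  using measurable_compose[OF measurable_Pair1' model_emp_measurable] by simp

lemma model_gap_measurable1:
  "i < n \<Longrightarrow> s \<in> space dataset_space \<Longrightarrow> (\<lambda>f. model_gap i f s) \<in> borel_measurable \<F>"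
  using measurable_compose[OF measurable_Pair1' model_gap_measurable] by simp

lemma task_emp_measurable: "(\<lambda>(A, s). task_emp A s) \<in> borel_measurable (\<A> \<Otimes>\<^sub>M dataset_space)"
proof -
  have "(\<lambda>w. (snd (fst w), snd w)) \<in> (\<A> \<Otimes>\<^sub>M dataset_space) \<Otimes>\<^sub>M \<F> \<rightarrow>\<^sub>M dataset_space \<Otimes>\<^sub>M \<F>"
    by simp
  from measurable_compose[OF this model_emp_measurable]
  have "(\<lambda>(w, f). model_emp f (snd w)) \<in> borel_measurable ((\<A> \<Otimes>\<^sub>M dataset_space) \<Otimes>\<^sub>M \<F>)"
    by (simp add: split_beta')
  from integral_measurable_prob_algebra2[OF this kernel] show ?thesis
    by (simp add: split_beta' task_emp_def)
qed

lemma task_risk_measurable: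
  assumes i: "i < n" shows "(\<lambda>(A, s). task_risk i A s) \<in> borel_measurable (\<A> \<Otimes>\<^sub>M dataset_space)"
proof -
  have "(\<lambda>(w, f). model_risk i f) \<in> borel_measurable ((\<A> \<Otimes>\<^sub>M dataset_space) \<Otimes>\<^sub>M \<F>)"
    using measurable_compose[OF measurable_snd model_risk_measurable[OF i]] by (simp add: split_beta')
  from integral_measurable_prob_algebra2[OF this kernel] show ?thesis
    by (simp add: split_beta' task_risk_def)
qed

lemma measurable_posterior:
  assumes "P \<in> space (prob_algebra M)" and "f \<in> borel_measurable M"
  shows "f \<in> borel_measurable P"
  using assms by (simp add: measurable_cong_sets[OF prob_algebra_facts(2)[OF assms(1)] refl])

lemma task_emp_range:
  assumes "A \<in> space \<A>" and "s \<in> space dataset_space" shows "task_emp A s \<in> {0..1}"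
  unfolding task_emp_def
proof (rule prob_space.integral_bounds(2))
  note p = posterior[OF assms]
  show "prob_space (A (inputs m s))" by (rule prob_algebra_facts[OF p])
  show "(\<lambda>f. model_emp f s) \<in> borel_measurable (A (inputs m s))"
    by (rule measurable_posterior[OF p model_emp_measurable1[OF assms(2)]])
  show "model_emp f s \<in> {0..1}" if "f \<in> space (A (inputs m s))" for f
    using that model_emp_range[OF assms(2)] by (simp add: prob_algebra_facts(3)[OF p])
qed

lemma task_risk_range:
  assumes "A \<in> space \<A>" and "s \<in> space dataset_space" and "i < n" shows "task_risk i A s \<in> {0..1}"
  unfolding task_risk_def
proof (rule prob_space.integral_bounds(2))
  note p = posterior[OF assms(1,2)]
  show "prob_space (A (inputs m s))" by (rule prob_algebra_facts[OF p])
  show "model_risk i \<in> borel_measurable (A (inputs m s))"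
    by (rule measurable_posterior[OF p model_risk_measurable[OF assms(3)]])
  show "model_risk i f \<in> {0..1}" if "f \<in> space (A (inputs m s))" for f
    using that model_risk_range[OF assms(3)] by (simp add: prob_algebra_facts(3)[OF p])
qed

lemma task_emp_eq:
  assumes "A \<in> space \<A>" and s: "s \<in> space dataset_space"
  shows "1 / real m * (\<Sum>j<m. \<integral>f. loss (snd (s j)) (f (fst (s j))) \<partial>A (inputs m s)) = task_emp A s"
proof -
  note p = posterior[OF assms]
  have "integrable (A (inputs m s)) (\<lambda>f. loss (snd (s j)) (f (fst (s j))))" if "j < m" for j
  proof (rule prob_space.integral_bounds(1))
    show "prob_space (A (inputs m s))" by (rule prob_algebra_facts[OF p])
    have "(\<lambda>f. (s j, f)) \<in> \<F> \<rightarrow>\<^sub>M (X \<Otimes>\<^sub>M Y) \<Otimes>\<^sub>M \<F>"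
      using dataset_component[OF s that] by (intro measurable_Pair1') (simp add: space_pair_measure)
    from measurable_compose[OF this loss_measurable']
    show "(\<lambda>f. loss (snd (s j)) (f (fst (s j)))) \<in> borel_measurable (A (inputs m s))"
      by (intro measurable_posterior[OF p]) simp
    show "loss (snd (s j)) (f (fst (s j))) \<in> {0..1}" if "f \<in> space (A (inputs m s))" for f
      using that \<open>j < m\<close> by (intro loss_unit dataset_component[OF s]) (simp_all add: prob_algebra_facts(3)[OF p])
  qed
  then show ?thesis
    unfolding task_emp_def model_emp_def by (simp add: integral_sum)
qed

text \<open>Fubini: the true risk integrates over the model innermost, while the variational
  argument needs the posterior outermost.\<close>

lemma task_risk_eq:
  assumes "A \<in> space \<A>" and s: "s \<in> space dataset_space" and i: "i < n"
  shows "(\<integral>(x, y). (\<integral>f. loss y (f x) \<partial>A (inputs m s)) \<partial>D i) = task_risk i A s"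
proof -
  note p = posterior[OF assms(1,2)]
  interpret a: prob_space "A (inputs m s)" by (rule prob_algebra_facts[OF p])
  interpret d: prob_space "D i" by (rule D_prob[OF i])
  interpret ad: pair_prob_space "A (inputs m s)" "D i" ..
  have "(\<lambda>(f, z). loss (snd z) (f (fst z))) \<in> borel_measurable (\<F> \<Otimes>\<^sub>M (X \<Otimes>\<^sub>M Y))"
    using measurable_compose[OF measurable_pair_swap' loss_measurable'] by (simp add: split_beta')
  then have meas: "(\<lambda>(f, z). loss (snd z) (f (fst z))) \<in> borel_measurable (A (inputs m s) \<Otimes>\<^sub>M D i)"
    by (simp add: measurable_cong_sets[OF sets_pair_measure_cong[OF prob_algebra_facts(2)[OF p] D_sets[OF i]] refl])
  have "integrable (A (inputs m s) \<Otimes>\<^sub>M D i) (\<lambda>(f, z). loss (snd z) (f (fst z)))"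
    by (rule ad.integral_bounds(1)[OF meas, of 0 1])
      (use loss_unit in \<open>auto simp: space_pair_measure D_space[OF i] prob_algebra_facts(3)[OF p]\<close>)
  from ad.Fubini_integral[OF this] show ?thesis
    unfolding task_risk_def model_risk_def by (simp add: split_beta')
qed

text \<open>A slope \<open>2 * m * y\<close> on the average is a slope \<open>2 * y\<close> on the
  sum of \<open>m\<close> terms, so Hoeffding gives
  \<open>m * (2 * y)^2 / 8 = m * y^2 / 2\<close>.\<close>

lemma model_gap_mgf:
  assumes "f \<in> space \<F>" and i: "i < n"
  shows "(\<integral>\<^sup>+s. ennreal (exp (2 * real m * y * model_gap i f s)) \<partial>(\<Pi>\<^sub>M j\<in>{..<m}. D i))
    \<le> ennreal (exp (real m * y\<^sup>2 / 2))"
proof -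
  interpret prob_space "D i" by (rule D_prob[OF i])
  have eq: "2 * real m * y * model_gap i f s
    = 2 * y * (\<Sum>j\<in>{..<m}. expectation (\<lambda>z. loss (snd z) (f (fst z))) - loss (snd (s j)) (f (fst (s j))))" for s
    using m by (simp add: model_gap_def model_risk_def model_emp_def sum_subtractf field_simps)
  have "(\<integral>\<^sup>+s. ennreal (exp (2 * real m * y * model_gap i f s)) \<partial>(\<Pi>\<^sub>M j\<in>{..<m}. D i))
    \<le> ennreal (exp (real (card {..<m}) * (2 * y)\<^sup>2 / 8))"
    unfolding eq
    by (rule iid_hoeffding_mgf[OF model_loss_measurable[OF assms]])
      (simp_all only: D_space[OF i] loss_unit assms finite_lessThan)
  then show ?thesis by (simp add: power_mult_distrib)
qed

end

section \<open>Generalization within the tasks\<close>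

context multi_task
begin

abbreviation data :: "('x, 'y) datasets measure" where
  "data \<equiv> \<Pi>\<^sub>M i\<in>{..<n}. \<Pi>\<^sub>M j\<in>{..<m}. D i"

definition exp_gap :: "real \<Rightarrow> nat \<Rightarrow> (nat \<Rightarrow> 'x \<times> 'y) \<Rightarrow> ('x, 'y) model \<Rightarrow> real" where
  "exp_gap y i s f = exp (2 * real m * y * model_gap i f s)"

text \<open>The product stands inside the integral over \<open>P\<close>: all tasks share one draw
  of the prior, and given it their models are drawn independently.\<close>

definition prior_mgf :: "('x, 'y) model measure measure \<Rightarrow> real \<Rightarrow> ('x, 'y) datasets \<Rightarrow> ennreal" where
  "prior_mgf \<P> y S = (\<integral>\<^sup>+P. (\<Prod>i<n. \<integral>\<^sup>+f. ennreal (exp_gap y i (S i) f) \<partial>P) \<partial>\<P>)"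

lemma data_component: "(\<lambda>S. S i) \<in> data \<rightarrow>\<^sub>M dataset_space" if "i < n"
proof -
  have "(\<lambda>S. S i) \<in> data \<rightarrow>\<^sub>M (\<Pi>\<^sub>M j\<in>{..<m}. D i)"
    using that by (intro measurable_component_singleton) simp
  then show ?thesis by (simp only: measurable_cong_sets[OF refl dataset_sets[OF that]])
qed

lemma data_component_space: "S \<in> space data \<Longrightarrow> i < n \<Longrightarrow> S i \<in> space dataset_space"
  using measurable_space[OF data_component] by blast

lemma data_prob: "prob_space data" and dataset_prob: "i < n \<Longrightarrow> prob_space (\<Pi>\<^sub>M j\<in>{..<m}. D i)"
  by (auto intro!: prob_space_PiM D_prob)

lemma exp_gap_measurable:
  "i < n \<Longrightarrow> (\<lambda>(s, f). exp_gap y i s f) \<in> borel_measurable (dataset_space \<Otimes>\<^sub>M \<F>)"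
  using model_gap_measurable unfolding exp_gap_def split_beta' by measurable

lemma prior_factor_measurable:
  assumes i: "i < n"
  shows "(\<lambda>(P, s). \<integral>\<^sup>+f. ennreal (exp_gap y i s f) \<partial>P) \<in> borel_measurable (prob_algebra \<F> \<Otimes>\<^sub>M dataset_space)"
proof -
  have "(\<lambda>w. (snd (fst w), snd w)) \<in> (prob_algebra \<F> \<Otimes>\<^sub>M dataset_space) \<Otimes>\<^sub>M \<F> \<rightarrow>\<^sub>M dataset_space \<Otimes>\<^sub>M \<F>"
    by simp
  from measurable_compose[OF measurable_compose[OF this exp_gap_measurable[OF i]] measurable_ennreal]
  have "(\<lambda>(w, f). ennreal (exp_gap y i (snd w) f)) \<in> borel_measurable ((prob_algebra \<F> \<Otimes>\<^sub>M dataset_space) \<Otimes>\<^sub>M \<F>)"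
    by (simp add: split_beta')
  from nn_integral_measurable_subprob_algebra2[OF this measurable_prob_algebraD[OF measurable_fst]]
  show ?thesis by (simp add: split_beta')
qed

lemma prior_product_measurable:
  "(\<lambda>(P, S). \<Prod>i<n. \<integral>\<^sup>+f. ennreal (exp_gap y i (S i) f) \<partial>P) \<in> borel_measurable (prob_algebra \<F> \<Otimes>\<^sub>M data)"
proof -
  have "(\<lambda>w. \<integral>\<^sup>+f. ennreal (exp_gap y i (snd w i) f) \<partial>fst w) \<in> borel_measurable (prob_algebra \<F> \<Otimes>\<^sub>M data)"
    if i: "i < n" for i
  proof -
    have "(\<lambda>w. (fst w, snd w i)) \<in> prob_algebra \<F> \<Otimes>\<^sub>M data \<rightarrow>\<^sub>M prob_algebra \<F> \<Otimes>\<^sub>M dataset_space"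
      using measurable_compose[OF measurable_snd data_component[OF i]] by (intro measurable_Pair measurable_fst)
    from measurable_compose[OF this prior_factor_measurable[OF i]] show ?thesis
      by (simp add: split_beta')
  qed
  then show ?thesis unfolding split_beta' by (intro borel_measurable_prod_ennreal) auto
qed

lemma prior_mgf_measurable:
  assumes "\<P> \<in> space (prob_algebra (prob_algebra \<F>))"
  shows "prior_mgf \<P> y \<in> borel_measurable data"
proof -
  note p = prob_algebra_facts[OF assms]
  interpret p: prob_space \<P> by (rule p)
  have "(\<lambda>(S, P). \<Prod>i<n. \<integral>\<^sup>+f. ennreal (exp_gap y i (S i) f) \<partial>P) \<in> borel_measurable (data \<Otimes>\<^sub>M prob_algebra \<F>)"
    using measurable_compose[OF measurable_pair_swap' prior_product_measurable] by (simp add: split_beta')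
  then have "(\<lambda>(S, P). \<Prod>i<n. \<integral>\<^sup>+f. ennreal (exp_gap y i (S i) f) \<partial>P) \<in> borel_measurable (data \<Otimes>\<^sub>M \<P>)"
    by (simp only: measurable_cong_sets[OF sets_pair_measure_cong[OF refl p(2)] refl])
  then show ?thesis unfolding prior_mgf_def by (rule p.borel_measurable_nn_integral)
qed

lemma prior_factor_mgf:
  assumes "P \<in> space (prob_algebra \<F>)" and i: "i < n"
  shows "(\<integral>\<^sup>+s. \<integral>\<^sup>+f. ennreal (exp_gap y i s f) \<partial>P \<partial>(\<Pi>\<^sub>M j\<in>{..<m}. D i)) \<le> ennreal (exp (real m * y\<^sup>2 / 2))"
proof -
  note p = prob_algebra_facts[OF assms(1)]
  interpret p: prob_space P by (rule p)
  interpret d: prob_space "\<Pi>\<^sub>M j\<in>{..<m}. D i" by (rule dataset_prob[OF i])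
  interpret pd: pair_prob_space P "\<Pi>\<^sub>M j\<in>{..<m}. D i" ..
  have "(\<lambda>(f, s). ennreal (exp_gap y i s f)) \<in> borel_measurable (\<F> \<Otimes>\<^sub>M dataset_space)"
    using measurable_compose[OF measurable_compose[OF measurable_pair_swap' exp_gap_measurable[OF i]] measurable_ennreal]
    by (simp add: split_beta')
  then have "(\<lambda>(f, s). ennreal (exp_gap y i s f)) \<in> borel_measurable (P \<Otimes>\<^sub>M (\<Pi>\<^sub>M j\<in>{..<m}. D i))"
    by (simp only: measurable_cong_sets[OF sets_pair_measure_cong[OF p(2) dataset_sets[OF i]] refl])
  from pd.Fubini'[OF this]
  have "(\<integral>\<^sup>+s. \<integral>\<^sup>+f. ennreal (exp_gap y i s f) \<partial>P \<partial>(\<Pi>\<^sub>M j\<in>{..<m}. D i))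
    = (\<integral>\<^sup>+f. \<integral>\<^sup>+s. ennreal (exp_gap y i s f) \<partial>(\<Pi>\<^sub>M j\<in>{..<m}. D i) \<partial>P)" .
  also have "\<dots> \<le> (\<integral>\<^sup>+f. ennreal (exp (real m * y\<^sup>2 / 2)) \<partial>P)"
    using model_gap_mgf[OF _ i] by (intro nn_integral_mono) (simp add: p(3) exp_gap_def)
  also have "\<dots> = ennreal (exp (real m * y\<^sup>2 / 2))"
    by (simp add: p.emeasure_space_1)
  finally show ?thesis .
qed

text \<open>The hyper-prior does not depend on the data, so Fubini allows averaging over the data
  first. For fixed \<open>P\<close> the average factorizes over the independent tasks into
  \<open>n\<close> factors of at most \<open>exp (m * y^2 / 2)\<close>.\<close>

lemma prior_mgf_expectation:
  assumes "\<P> \<in> space (prob_algebra (prob_algebra \<F>))"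
  shows "(\<integral>\<^sup>+S. prior_mgf \<P> y S \<partial>data) \<le> ennreal (exp (real (m * n) * y\<^sup>2 / 2))"
proof -
  note p = prob_algebra_facts[OF assms]
  interpret p: prob_space \<P> by (rule p)
  interpret d: prob_space data by (rule data_prob)
  interpret pd: pair_prob_space \<P> data ..
  \<comment> \<open>\<open>D i\<close> is arbitrary for \<open>i \<ge> n\<close>, but
    \<open>product_sigma_finite\<close> speaks of all indices; dummy point masses there leave
    \<open>data\<close> unchanged.\<close>
  define M' where "M' i = (if i < n then (\<Pi>\<^sub>M j\<in>{..<m}. D i) else return (count_space UNIV) undefined)" for i
  have M'_prob: "prob_space (M' i)" for i
    by (cases "i < n") (auto simp: M'_def dataset_prob intro: prob_space_return)
  interpret M': product_sigma_finite M'
    using M'_prob by (intro product_sigma_finite.intro prob_space_imp_sigma_finite)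
  have data_eq: "data = Pi\<^sub>M {..<n} M'"
    by (intro PiM_cong) (auto simp: M'_def)
  have prod: "(\<integral>\<^sup>+S. (\<Prod>i<n. \<integral>\<^sup>+f. ennreal (exp_gap y i (S i) f) \<partial>P) \<partial>data)
      \<le> ennreal (exp (real (m * n) * y\<^sup>2 / 2))" if P: "P \<in> space (prob_algebra \<F>)" for P
  proof -
    have meas: "(\<lambda>s. \<integral>\<^sup>+f. ennreal (exp_gap y i s f) \<partial>P) \<in> borel_measurable (M' i)" if "i < n" for i
    proof -
      have "(\<lambda>s. \<integral>\<^sup>+f. ennreal (exp_gap y i s f) \<partial>P) \<in> borel_measurable dataset_space"
        using measurable_compose[OF measurable_Pair1'[OF P] prior_factor_measurable[OF that]] by simp
      then show ?thesis
        using that by (simp add: M'_def measurable_cong_sets[OF dataset_sets[OF that] refl])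
    qed
    have "(\<integral>\<^sup>+S. (\<Prod>i<n. \<integral>\<^sup>+f. ennreal (exp_gap y i (S i) f) \<partial>P) \<partial>data)
      = (\<Prod>i<n. \<integral>\<^sup>+s. \<integral>\<^sup>+f. ennreal (exp_gap y i s f) \<partial>P \<partial>M' i)"
      unfolding data_eq using meas by (intro M'.product_nn_integral_prod) auto
    also have "\<dots> \<le> (\<Prod>i<n. ennreal (exp (real m * y\<^sup>2 / 2)))"
      using prior_factor_mgf[OF P] by (intro prod_mono_ennreal) (simp add: M'_def)
    also have "\<dots> = ennreal (exp (real (m * n) * y\<^sup>2 / 2))"
      by (simp add: ennreal_power exp_of_nat_mult[symmetric] mult_ac)
    finally show ?thesis .
  qed
  have "(\<lambda>(P, S). \<Prod>i<n. \<integral>\<^sup>+f. ennreal (exp_gap y i (S i) f) \<partial>P) \<in> borel_measurable (\<P> \<Otimes>\<^sub>M data)"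
    using prior_product_measurable by (simp only: measurable_cong_sets[OF sets_pair_measure_cong[OF p(2) refl] refl])
  from pd.Fubini'[OF this]
  have "(\<integral>\<^sup>+S. prior_mgf \<P> y S \<partial>data)
    = (\<integral>\<^sup>+P. \<integral>\<^sup>+S. (\<Prod>i<n. \<integral>\<^sup>+f. ennreal (exp_gap y i (S i) f) \<partial>P) \<partial>data \<partial>\<P>)"
    unfolding prior_mgf_def .
  also have "\<dots> \<le> (\<integral>\<^sup>+P. ennreal (exp (real (m * n) * y\<^sup>2 / 2)) \<partial>\<P>)"
    using prod by (intro nn_integral_mono) (simp add: p(3))
  also have "\<dots> = ennreal (exp (real (m * n) * y\<^sup>2 / 2))"
    by (simp add: p.emeasure_space_1)
  finally show ?thesis .
qed

text \<open>
  The variational inequality is used once for each task, with the prior \<open>P\<close>, and once for the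
  hyper-prior, where the logarithm of the product of the per-task moment generating functions is the
  test function.
\<close>
lemma complexity_ge:
  assumes S: "\<And>i. i < n \<Longrightarrow> S i \<in> space dataset_space" and A: "A \<in> space \<A>"
    and \<P>: "\<P> \<in> space (prob_algebra (prob_algebra \<F>))"
    and Q: "\<Q> A \<in> space (prob_algebra (prob_algebra \<F>))" and y: "0 < y"
    and le: "prior_mgf \<P> y S \<le> ennreal b"
  shows "ennreal (2 * real m * y * (\<Sum>i<n. task_risk i A (S i) - task_emp A (S i)) - ln b)
    \<le> complexity n m S A \<Q> \<P>"
proof -
  note p = prob_algebra_facts[OF \<P>] and q = prob_algebra_facts[OF Q]
  interpret p: prob_space \<P> by (rule p)
  interpret q: prob_space "\<Q> A" by (rule q)
  define c where "c = 2 * real m * y"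
  define \<psi> where "\<psi> i P = (\<integral>f. exp_gap y i (S i) f \<partial>P)" for i P
  define L where "L P = (\<Sum>i<n. ln (\<psi> i P))" for P
  define t where "t i = c * (task_risk i A (S i) - task_emp A (S i))" for i
  have c: "0 \<le> c" using y by (simp add: c_def)
  have gap_bound: "\<bar>c * model_gap i f (S i)\<bar> \<le> c" if "i < n" "f \<in> space \<F>" for i f
    using model_gap_range[OF that(1) S[OF that(1)] that(2)] c by (simp add: abs_mult mult_left_le)
  have exp_range: "exp_gap y i (S i) f \<in> {exp (- c)..exp c}" if "i < n" "f \<in> space \<F>" for i f
    using gap_bound[OF that] by (auto simp: exp_gap_def c_def[symmetric] abs_le_iff)
  have exp_meas: "(\<lambda>f. exp_gap y i (S i) f) \<in> borel_measurable \<F>" if "i < n" for i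
    using measurable_compose[OF measurable_Pair1'[OF S[OF that]] exp_gap_measurable[OF that]] by simp
  have \<psi>: "integrable P (\<lambda>f. exp_gap y i (S i) f)" "\<psi> i P \<in> {exp (- c)..exp c}"
    if "i < n" "P \<in> space (prob_algebra \<F>)" for i P
    using prob_space.integral_bounds[OF prob_algebra_facts(1)[OF that(2)] measurable_posterior[OF that(2) exp_meas[OF that(1)]], of "exp (- c)" "exp c"]
      exp_range[OF that(1)] by (auto simp: \<psi>_def prob_algebra_facts(3)[OF that(2)])
  have \<psi>_pos: "0 < \<psi> i P" if "i < n" "P \<in> space (prob_algebra \<F>)" for i P
    using \<psi>(2)[OF that] by (auto intro: less_le_trans[OF exp_gt_zero])
  have \<psi>_meas: "\<psi> i \<in> borel_measurable (prob_algebra \<F>)" if "i < n" for i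
    unfolding \<psi>_def
    by (rule measurable_compose[OF measurable_prob_algebraD[OF measurable_ident_sets[OF refl]]
          integral_measurable_subprob_algebra[OF exp_meas[OF that]]])
  have L_meas: "L \<in> borel_measurable (prob_algebra \<F>)"
    unfolding L_def using \<psi>_meas by (intro borel_measurable_sum borel_measurable_ln) auto
  have L_bound: "\<bar>L P\<bar> \<le> real n * c" if "P \<in> space (prob_algebra \<F>)" for P
  proof -
    have "\<bar>ln (\<psi> i P)\<bar> \<le> c" if i: "i < n" for i
    proof -
      have "ln (exp (- c)) \<le> ln (\<psi> i P)" "ln (\<psi> i P) \<le> ln (exp c)"
        using \<psi>(2)[OF i \<open>P \<in> _\<close>] \<psi>_pos[OF i \<open>P \<in> _\<close>] by (simp_all only: ln_le_cancel_iff exp_gt_zero atLeastAtMost_iff)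
      then show ?thesis by (simp add: abs_le_iff)
    qed
    then have "(\<Sum>i<n. \<bar>ln (\<psi> i P)\<bar>) \<le> (\<Sum>i<n. c)" by (intro sum_mono) auto
    then show ?thesis unfolding L_def by (intro order_trans[OF sum_abs]) simp
  qed
  have L_range: "L P \<in> {- (real n * c)..real n * c}" if "P \<in> space (prob_algebra \<F>)" for P
    using L_bound[OF that] by (simp add: abs_le_iff minus_le_iff)
  have exp_L: "exp (L P) = (\<Prod>i<n. \<psi> i P)" if "P \<in> space (prob_algebra \<F>)" for P
    using \<psi>_pos[OF _ that] by (simp add: L_def exp_sum)
  have L_intq: "integrable (\<Q> A) L"
    by (rule q.integral_bounds(1)[of _ "- (real n * c)" "real n * c"])
      (use L_range measurable_posterior[OF Q L_meas] in \<open>simp_all only: q(3)\<close>)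
  have task: "ennreal (t i - ln (\<psi> i P)) \<le> KL (A (inputs m (S i))) P" if "i < n" "P \<in> space (prob_algebra \<F>)" for i P
  proof -
    note a = posterior[OF A S[OF that(1)]]
    note a' = prob_algebra_facts[OF a] and P' = prob_algebra_facts[OF that(2)]
    have "(\<integral>f. c * model_gap i f (S i) \<partial>A (inputs m (S i))) = t i"
    proof -
      have "integrable (A (inputs m (S i))) (model_risk i)"
        by (rule prob_space.integral_bounds(1)[OF a'(1) measurable_posterior[OF a model_risk_measurable[OF that(1)]], of 0 1])
          (use model_risk_range[OF that(1)] in \<open>simp add: a'(3)\<close>)
      moreover have "integrable (A (inputs m (S i))) (\<lambda>f. model_emp f (S i))"
        by (rule prob_space.integral_bounds(1)[OF a'(1) measurable_posterior[OF a model_emp_measurable1[OF S[OF that(1)]]], of 0 1])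
          (use model_emp_range[OF S[OF that(1)]] in \<open>simp add: a'(3)\<close>)
      ultimately show ?thesis by (simp add: model_gap_def t_def task_risk_def task_emp_def)
    qed
    moreover have "ennreal ((\<integral>f. c * model_gap i f (S i) \<partial>A (inputs m (S i))) - ln (\<integral>f. exp (c * model_gap i f (S i)) \<partial>P))
      \<le> KL (A (inputs m (S i))) P"
    proof (rule KL_variational[OF P'(1) a'(1)])
      show "(\<lambda>f. c * model_gap i f (S i)) \<in> borel_measurable P"
        using model_gap_measurable1[OF that(1) S[OF that(1)]] by (intro measurable_posterior[OF that(2)]) simp
      show "\<bar>c * model_gap i f (S i)\<bar> \<le> c" if "f \<in> space P" for f
        using that gap_bound[OF \<open>i < n\<close>] by (simp add: P'(3))
    qed (simp add: a' P')
    ultimately show ?thesis by (simp add: \<psi>_def exp_gap_def c_def)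
  qed
  have "ennreal ((\<Sum>i<n. t i) - (\<integral>P. L P \<partial>\<Q> A)) = ennreal (\<integral>P. (\<Sum>i<n. t i) - L P \<partial>\<Q> A)"
    using L_intq by (simp add: q.prob_space)
  also have "\<dots> \<le> (\<integral>\<^sup>+P. ennreal ((\<Sum>i<n. t i) - L P) \<partial>\<Q> A)"
    by (rule ennreal_integral_le_nn_integral)
  also have "\<dots> \<le> (\<integral>\<^sup>+P. (\<Sum>i<n. KL (A (inputs m (S i))) P) \<partial>\<Q> A)"
  proof (rule nn_integral_mono)
    fix P assume "P \<in> space (\<Q> A)"
    then have P: "P \<in> space (prob_algebra \<F>)" by (simp add: q(3))
    have "ennreal ((\<Sum>i<n. t i) - L P) = ennreal (\<Sum>i<n. t i - ln (\<psi> i P))"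
      by (simp add: L_def sum_subtractf)
    also have "\<dots> \<le> (\<Sum>i<n. ennreal (t i - ln (\<psi> i P)))" by (rule ennreal_sum_le)
    also have "\<dots> \<le> (\<Sum>i<n. KL (A (inputs m (S i))) P)" using task[OF _ P] by (intro sum_mono) auto
    finally show "ennreal ((\<Sum>i<n. t i) - L P) \<le> (\<Sum>i<n. KL (A (inputs m (S i))) P)" .
  qed
  finally have 1: "ennreal ((\<Sum>i<n. t i) - (\<integral>P. L P \<partial>\<Q> A)) \<le> (\<integral>\<^sup>+P. (\<Sum>i<n. KL (A (inputs m (S i))) P) \<partial>\<Q> A)" .
  have 2: "ennreal ((\<integral>P. L P \<partial>\<Q> A) - ln (\<integral>P. exp (L P) \<partial>\<P>)) \<le> KL (\<Q> A) \<P>"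
    by (rule KL_variational[OF p(1) q(1), where c = "real n * c"])
      (use L_bound measurable_posterior[OF \<P> L_meas] in \<open>auto simp: p(2,3) q(2)\<close>)
  have exp_L_range: "exp (L P) \<in> {exp (- (real n * c))..exp (real n * c)}" if "P \<in> space \<P>" for P
    using L_range[of P] that by (simp add: p(3))
  have exp_L_meas: "(\<lambda>P. exp (L P)) \<in> borel_measurable \<P>"
    by (rule measurable_compose[OF measurable_posterior[OF \<P> L_meas] borel_measurable_exp])
  note int = p.integral_bounds(1)[OF exp_L_meas exp_L_range]
    and Z = p.integral_bounds(2)[OF exp_L_meas exp_L_range]
  have Z0: "0 < (\<integral>P. exp (L P) \<partial>\<P>)" using Z by (auto intro: less_le_trans[OF exp_gt_zero])
  have "prior_mgf \<P> y S = (\<integral>\<^sup>+P. ennreal (exp (L P)) \<partial>\<P>)"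
    unfolding prior_mgf_def
  proof (rule nn_integral_cong)
    fix P assume "P \<in> space \<P>"
    then have P: "P \<in> space (prob_algebra \<F>)" by (simp add: p(3))
    have "(\<integral>\<^sup>+f. ennreal (exp_gap y i (S i) f) \<partial>P) = ennreal (\<psi> i P)" if "i < n" for i
      unfolding \<psi>_def using \<psi>(1)[OF that P] by (intro nn_integral_eq_integral) (auto simp: exp_gap_def)
    then have "(\<Prod>i<n. \<integral>\<^sup>+f. ennreal (exp_gap y i (S i) f) \<partial>P) = (\<Prod>i<n. ennreal (\<psi> i P))"
      by (intro prod.cong) auto
    also have "\<dots> = ennreal (\<Prod>i<n. \<psi> i P)"
      using \<psi>_pos[OF _ P] by (intro prod_ennreal) (simp add: less_imp_le)
    finally show "(\<Prod>i<n. \<integral>\<^sup>+f. ennreal (exp_gap y i (S i) f) \<partial>P) = ennreal (exp (L P))"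
      by (simp only: exp_L[OF P])
  qed
  also have "\<dots> = ennreal (\<integral>P. exp (L P) \<partial>\<P>)"
    using int by (intro nn_integral_eq_integral) auto
  \<comment> \<open>No sign is assumed of \<open>b\<close>; positivity of the integral excludes that
    \<open>ennreal b\<close> is a truncated negative number.\<close>
  finally have "(\<integral>P. exp (L P) \<partial>\<P>) \<le> b"
    using le Z0 by (auto simp: ennreal_le_iff2)
  then have "ln (\<integral>P. exp (L P) \<partial>\<P>) \<le> ln b" using Z0 by simp
  \<comment> \<open>The mean of \<open>L\<close> under \<open>\<Q> A\<close> enters the two
    variational bounds with opposite signs and cancels.\<close>
  then have "ennreal ((\<Sum>i<n. t i) - ln b)
    \<le> ennreal (((\<integral>P. L P \<partial>\<Q> A) - ln (\<integral>P. exp (L P) \<partial>\<P>)) + ((\<Sum>i<n. t i) - (\<integral>P. L P \<partial>\<Q> A)))"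
    by (intro ennreal_leI) simp
  also have "\<dots> \<le> complexity n m S A \<Q> \<P>"
    unfolding complexity_def using 1 2 by (intro order_trans[OF ennreal_add_le] add_mono)
  finally show ?thesis
    by (simp add: t_def c_def sum_distrib_left)
qed

end

section \<open>Generalization to the unlabeled tasks\<close>

lemma subset_gap_range:
  assumes "I \<subseteq> {..<n}" and "0 < card I" and "card I < n" and range: "\<And>i. i < n \<Longrightarrow> g i \<in> {0..1}"
  shows "subset_gap n g I \<in> {-1..1}"
proof -
  have fin: "finite I" using assms(1) by (rule finite_subset) simp
  have avg: "0 \<le> sum g J / real (card J)" "sum g J / real (card J) \<le> 1" if "J \<subseteq> {..<n}" "0 < card J" for J
  proof -
    have "0 \<le> sum g J" using that range by (intro sum_nonneg) force
    moreover have "sum g J \<le> (\<Sum>i\<in>J. 1)" using that range by (intro sum_mono) force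
    ultimately show "0 \<le> sum g J / real (card J)" "sum g J / real (card J) \<le> 1"
      using that by simp_all
  qed
  have "card ({..<n} - I) = n - card I" using assms fin by (simp add: card_Diff_subset)
  then have "0 \<le> (\<Sum>i\<in>{..<n} - I. g i) / real (n - card I)" "(\<Sum>i\<in>{..<n} - I. g i) / real (n - card I) \<le> 1"
    using avg[of "{..<n} - I"] assms(3) by (simp_all only: Diff_subset zero_less_diff)
  moreover have "b - a \<in> {-1..1}" if "0 \<le> a" "a \<le> 1" "0 \<le> b" "b \<le> 1" for a b :: real
    using that by simp
  ultimately show ?thesis
    unfolding subset_gap_def using avg[OF assms(1,2)] by blast
qed

text \<open>The population mean is the convex combination of the means over \<open>I\<close> and its
  complement, with weights proportional to their sizes.\<close>

lemma average_eq_subset_gap: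
  assumes "I \<subseteq> {..<n}" and "0 < card I" and "card I < n"
  shows "(\<Sum>i<n. g i) / real n
    = (\<Sum>i\<in>I. g i) / real (card I) + real (n - card I) / real n * subset_gap n g I"
proof -
  have "finite I" using assms(1) by (rule finite_subset) simp
  then have "(\<Sum>i<n. g i) = (\<Sum>i\<in>I. g i) + (\<Sum>i\<in>{..<n} - I. g i)"
    using sum.subset_diff[OF assms(1)] by (simp add: add.commute)
  moreover have "(a + b) / (k + u) = a / k + u / (k + u) * (b / u - a / k)" if "0 < k" "0 < u" for a b k u :: real
  proof -
    have "(c * k + d * u) / (k + u) = c + u / (k + u) * (d - c)" for c d
      using that by (simp add: field_simps)
    from this[of "a / k" "b / u"] show ?thesis using that by simp
  qed
  from this[of "real (card I)" "real (n - card I)"]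
  have "(a + b) / real n = a / real (card I) + real (n - card I) / real n * (b / real (n - card I) - a / real (card I))" for a b
    using assms by (simp only: of_nat_add[symmetric] le_add_diff_inverse less_imp_le of_nat_0_less_iff zero_less_diff)
  ultimately show ?thesis by (simp only: subset_gap_def)
qed

lemma ennreal_mult_le_divide:
  assumes "0 < c" and "ennreal c * x \<le> ennreal d" and "0 \<le> d"
  shows "x \<le> ennreal (d / c)"
proof (cases x)
  case (real r)
  with assms have "c * r \<le> d" by (simp add: ennreal_mult[symmetric])
  with real assms show ?thesis by (simp add: field_simps)
next
  case top
  with assms show ?thesis by (simp add: ennreal_mult_top top_unique)
qed

text \<open>Independent samples have the variance proxy \<open>N\<close> exactly, so there is no
  excess. With \<open>N\<close> slopes the loss is \<open>1 / (2 * N) \<le> 1/6\<close>, below the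
  logarithm of 3/50 * 8 * e > 6/5. The factor e in the threshold accounts for the summand 1 in the
  radicand.\<close>

lemma sample_cover:
  assumes "3 \<le> N"
  shows "grid_cover N (\<lambda>k. (2 * real k + 1) / real N) (real N) (real N) (3/50) (8 * exp 1 * real N)"
proof (rule grid_cover_uniform[where \<epsilon> = 0])
  have "(1/6 :: real) \<le> ln (6/5)" using ln_ge_ratio[of 1 5 6 6] by simp
  also have "(6/5 :: real) \<le> 12/25 * exp 1"
    using exp_lower_Taylor_quadratic[of 1] by simp
  then have "ln (6/5) \<le> ln (12/25 * exp 1 :: real)" by (subst ln_le_cancel_iff) auto
  finally have "1/6 \<le> ln (12/25 * exp 1 :: real)" .
  moreover have "real N / (2 * (real N)\<^sup>2) \<le> 1/6"
    using assms by (simp add: power2_eq_square field_simps)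
  moreover have "3/50 * (8 * exp 1 * real N) / real N = 12/25 * exp 1"
    using assms by simp
  ultimately show "real N / (2 * (real N)\<^sup>2) + 2 * 0 \<le> ln (3/50 * (8 * exp 1 * real N) / real N)"
    by simp
qed (use assms in auto)

text \<open>On the good event, the component of the mixture with weight
  \<open>\<theta> / K * exp (- (B * (y k)^2 / 2))\<close> is at most \<open>1 / \<delta>\<close>
  divided by that weight. The logarithm of this quotient splits into the penalty of
  \<open>grid_cover_bound\<close> and the quadratic term.\<close>

lemma grid_cover_bound_mgf:
  assumes cover: "grid_cover K y q B \<theta> t" and "0 < \<theta>" and "0 < t" and "0 < \<delta>" and "\<delta> \<le> 1" and "0 \<le> c"
    and "D \<le> 1" and "0 < D"
    and mgf: "\<And>k. k < K \<Longrightarrow>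
      ennreal (2 * q * y k * D - ln (1 / \<delta> / (\<theta> / real K * exp (- (B * (y k)\<^sup>2 / 2))))) \<le> ennreal c"
  shows "2 * q * D\<^sup>2 \<le> c + ln (t / \<delta>)"
proof (rule grid_cover_bound[OF cover assms(2-8)])
  fix k assume k: "k < K"
  have "1 / \<delta> / (\<theta> / real K * exp (- (B * (y k)\<^sup>2 / 2))) = real K / (\<theta> * \<delta>) * exp (B * (y k)\<^sup>2 / 2)"
    by (simp add: exp_minus field_simps)
  moreover have "ln (real K / (\<theta> * \<delta>) * exp (B * (y k)\<^sup>2 / 2)) = ln (real K / (\<theta> * \<delta>)) + B * (y k)\<^sup>2 / 2"
    using assms(2,4) k by (subst ln_mult) auto
  ultimately have "ln (1 / \<delta> / (\<theta> / real K * exp (- (B * (y k)\<^sup>2 / 2)))) = ln (real K / (\<theta> * \<delta>)) + B * (y k)\<^sup>2 / 2"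
    by (simp only:)
  then show "2 * q * y k * D - B * (y k)\<^sup>2 / 2 \<le> c + ln (real K / (\<theta> * \<delta>))"
    using mgf[OF k] \<open>0 \<le> c\<close> by (simp add: ennreal_le_iff)
qed

text \<open>Follows from 3 * 2/3 * 1/2 = 1, as \<open>ln nL \<ge> 2/3\<close> and
  \<open>sqrt q \<ge> 1/2\<close>. It keeps the logarithm in the labeled-task radicand nonnegative
  for \<open>\<delta> \<le> 1\<close>.\<close>

lemma t_factor_ge_1:
  assumes "2 \<le> nL" and "nL < n"
  shows "1 \<le> t_factor nL n"
proof -
  define q where "q = real nL * real (n - nL) / real n"
  have "0 \<le> (real nL - 1) * (real (n - nL) - 1)" using assms by (intro mult_nonneg_nonneg) auto
  then have "real n - 1 \<le> real nL * real (n - nL)" using assms by (simp add: algebra_simps of_nat_diff)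
  moreover have "1/4 * real n \<le> real n - 1" using assms by simp
  ultimately have "1/4 \<le> q" using assms unfolding q_def by (subst pos_le_divide_eq) auto
  then have "1/2 \<le> sqrt q" by (intro real_le_rsqrt) (simp add: power2_eq_square)
  have "2/3 \<le> ln (real nL)"
    using ln2_ge_two_thirds assms by (intro order_trans[OF ln2_ge_two_thirds ln_mono]) auto
  from t_factor_ge(4)[OF assms q_def _ this] \<open>1/2 \<le> sqrt q\<close> show ?thesis by simp
qed

context multi_task
begin

section \<open>Exponential moments of the gap over the random set of labeled tasks\<close>

definition labeled_mgf :: "('x, 'y) algorithm measure \<Rightarrow> real \<Rightarrow> nat set \<Rightarrow> ('x, 'y) datasets \<Rightarrow> ennreal" where
  "labeled_mgf \<pi> c I S = (\<integral>\<^sup>+A. ennreal (exp (c * subset_gap n (\<lambda>i. task_emp A (S i)) I)) \<partial>\<pi>)"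

lemma subset_gap_measurable:
  assumes "I \<subseteq> {..<n}"
  shows "(\<lambda>(S, A). subset_gap n (\<lambda>i. task_emp A (S i)) I) \<in> borel_measurable (data \<Otimes>\<^sub>M \<A>)"
proof -
  have emp: "(\<lambda>w. task_emp (snd w) (fst w i)) \<in> borel_measurable (data \<Otimes>\<^sub>M \<A>)" if "i < n" for i
  proof -
    have "(\<lambda>w. (snd w, fst w i)) \<in> data \<Otimes>\<^sub>M \<A> \<rightarrow>\<^sub>M \<A> \<Otimes>\<^sub>M dataset_space"
      using measurable_compose[OF measurable_fst data_component[OF that]] by (intro measurable_Pair measurable_snd)
    from measurable_compose[OF this task_emp_measurable] show ?thesis by (simp add: split_beta')
  qed
  show ?thesis
    unfolding subset_gap_def split_beta' using assms
    by (intro borel_measurable_diff borel_measurable_divide borel_measurable_sum emp) auto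
qed

lemma task_emp_measurable1: "s \<in> space dataset_space \<Longrightarrow> (\<lambda>A. task_emp A s) \<in> borel_measurable \<A>"
  using measurable_compose[OF measurable_Pair2' task_emp_measurable] by simp

lemma task_risk_measurable1:
  "i < n \<Longrightarrow> s \<in> space dataset_space \<Longrightarrow> (\<lambda>A. task_risk i A s) \<in> borel_measurable \<A>"
  using measurable_compose[OF measurable_Pair2' task_risk_measurable] by simp

lemma labeled_mgf_measurable:
  assumes "\<pi> \<in> space (prob_algebra \<A>)" and "I \<subseteq> {..<n}"
  shows "labeled_mgf \<pi> c I \<in> borel_measurable data"
proof -
  note p = prob_algebra_facts[OF assms(1)]
  interpret p: prob_space \<pi> by (rule p)
  have "(\<lambda>(S, A). subset_gap n (\<lambda>i. task_emp A (S i)) I) \<in> borel_measurable (data \<Otimes>\<^sub>M \<pi>)"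
    using subset_gap_measurable[OF assms(2)]
    by (simp only: measurable_cong_sets[OF sets_pair_measure_cong[OF refl p(2)] refl])
  then have "(\<lambda>(S, A). ennreal (exp (c * subset_gap n (\<lambda>i. task_emp A (S i)) I))) \<in> borel_measurable (data \<Otimes>\<^sub>M \<pi>)"
    unfolding split_beta' by measurable
  then show ?thesis unfolding labeled_mgf_def by (rule p.borel_measurable_nn_integral)
qed

text \<open>For fixed data and a fixed algorithm only \<open>I\<close> is random, and
  \<open>subset_gap_mgf\<close> bounds the sum over \<open>I\<close> pointwise. It remains to move
  finite sums under the integrals.\<close>

lemma labeled_mgf_expectation:
  assumes \<pi>: "\<pi> \<in> space (prob_algebra \<A>)" and k: "0 < k" "k < n"
    and q: "q = real k * real (n - k) / real n" and "p \<in> {k, n - k}"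
  shows "(\<Sum>I | I \<subseteq> {..<n} \<and> card I = k. \<integral>\<^sup>+S. labeled_mgf \<pi> (2 * q * y) I S \<partial>data)
    \<le> ennreal (real (card {I. I \<subseteq> {..<n} \<and> card I = k}) * exp (serfling_factor p n * y\<^sup>2 / 2))"
    (is "(\<Sum>I\<in>?fam. _ I) \<le> ennreal ?b")
proof -
  note p = prob_algebra_facts[OF \<pi>]
  interpret p: prob_space \<pi> by (rule p)
  interpret d: prob_space data by (rule data_prob)
  have "(\<Sum>I\<in>?fam. \<integral>\<^sup>+S. labeled_mgf \<pi> (2 * q * y) I S \<partial>data)
    = (\<integral>\<^sup>+S. (\<Sum>I\<in>?fam. labeled_mgf \<pi> (2 * q * y) I S) \<partial>data)"
    using labeled_mgf_measurable[OF \<pi>] by (intro nn_integral_sum[symmetric]) auto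
  also have "\<dots> \<le> (\<integral>\<^sup>+S. ennreal ?b \<partial>data)"
  proof (rule nn_integral_mono)
    fix S assume S: "S \<in> space data"
    have "(\<lambda>A. subset_gap n (\<lambda>i. task_emp A (S i)) I) \<in> borel_measurable \<pi>" if "I \<in> ?fam" for I
      using measurable_compose[OF measurable_Pair1'[OF S] subset_gap_measurable[of I]] that
      by (intro measurable_posterior[OF \<pi>]) simp
    then have "(\<Sum>I\<in>?fam. labeled_mgf \<pi> (2 * q * y) I S)
      = (\<integral>\<^sup>+A. (\<Sum>I\<in>?fam. ennreal (exp (2 * q * y * subset_gap n (\<lambda>i. task_emp A (S i)) I))) \<partial>\<pi>)"
      unfolding labeled_mgf_def by (intro nn_integral_sum[symmetric]) measurable
    also have "\<dots> \<le> (\<integral>\<^sup>+A. ennreal ?b \<partial>\<pi>)"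
    proof (rule nn_integral_mono)
      fix A assume "A \<in> space \<pi>"
      then have "task_emp A (S i) \<in> {0..1}" if "i < n" for i
        using task_emp_range data_component_space[OF S that] by (simp add: p(3))
      from subset_gap_mgf[where y = y, OF k this q assms(5)]
      show "(\<Sum>I\<in>?fam. ennreal (exp (2 * q * y * subset_gap n (\<lambda>i. task_emp A (S i)) I))) \<le> ennreal ?b"
        by (subst sum_ennreal) (auto intro!: ennreal_leI)
    qed
    also have "\<dots> = ennreal ?b" by (simp add: p.emeasure_space_1)
    finally show "(\<Sum>I\<in>?fam. labeled_mgf \<pi> (2 * q * y) I S) \<le> ennreal ?b" .
  qed
  also have "\<dots> = ennreal ?b" by (simp add: d.emeasure_space_1)
  finally show ?thesis .
qed

lemma labeled_gap_facts:
  assumes S: "S \<in> space data" and I: "I \<subseteq> {..<n}" "0 < card I" "card I < n"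
  shows "(\<lambda>A. subset_gap n (\<lambda>i. task_emp A (S i)) I) \<in> borel_measurable \<A>"
    and "A \<in> space \<A> \<Longrightarrow> subset_gap n (\<lambda>i. task_emp A (S i)) I \<in> {-1..1}"
  using measurable_compose[OF measurable_Pair1'[OF S] subset_gap_measurable[OF I(1)]]
    subset_gap_range[OF I, of "\<lambda>i. task_emp A (S i)"] task_emp_range data_component_space[OF S] by auto

text \<open>The variational inequality with \<open>c\<close> times the gap as test function;
  \<open>labeled_mgf\<close> is its normalizing integral under the meta-prior.\<close>

lemma KL_ge_labeled:
  assumes \<pi>: "\<pi> \<in> space (prob_algebra \<A>)" and \<rho>: "\<rho> \<in> space (prob_algebra \<A>)"
    and S: "S \<in> space data" and I: "I \<subseteq> {..<n}" "0 < card I" "card I < n"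
    and le: "labeled_mgf \<pi> c I S \<le> ennreal b"
  shows "ennreal (c * (\<integral>A. subset_gap n (\<lambda>i. task_emp A (S i)) I \<partial>\<rho>) - ln b) \<le> KL \<rho> \<pi>"
proof -
  note p = prob_algebra_facts[OF \<pi>] and r = prob_algebra_facts[OF \<rho>]
  interpret p: prob_space \<pi> by (rule p)
  define g where "g A = c * subset_gap n (\<lambda>i. task_emp A (S i)) I" for A
  have g: "g \<in> borel_measurable \<A>" unfolding g_def using labeled_gap_facts(1)[OF S I] by simp
  have g_bound: "\<bar>g A\<bar> \<le> \<bar>c\<bar>" if "A \<in> space \<A>" for A
    using labeled_gap_facts(2)[OF S I that] unfolding g_def
    by (simp add: abs_mult mult_left_le abs_le_iff)
  have exp_range: "exp (g A) \<in> {exp (- \<bar>c\<bar>)..exp \<bar>c\<bar>}" if "A \<in> space \<pi>" for A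
    using g_bound[of A] that by (simp add: p(3) abs_le_iff)
  have exp_meas: "(\<lambda>A. exp (g A)) \<in> borel_measurable \<pi>"
    by (rule measurable_compose[OF measurable_posterior[OF \<pi> g] borel_measurable_exp])
  note int = p.integral_bounds(1)[OF exp_meas exp_range] and Z = p.integral_bounds(2)[OF exp_meas exp_range]
  have Z0: "0 < (\<integral>A. exp (g A) \<partial>\<pi>)" using Z by (auto intro: less_le_trans[OF exp_gt_zero])
  have "labeled_mgf \<pi> c I S = ennreal (\<integral>A. exp (g A) \<partial>\<pi>)"
    unfolding labeled_mgf_def g_def[symmetric] using int by (intro nn_integral_eq_integral) auto
  then have "(\<integral>A. exp (g A) \<partial>\<pi>) \<le> b"
    using le Z0 by (auto simp: ennreal_le_iff2)
  then have "ln (\<integral>A. exp (g A) \<partial>\<pi>) \<le> ln b" using Z0 by simp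
  then have "ennreal ((\<integral>A. g A \<partial>\<rho>) - ln b) \<le> ennreal ((\<integral>A. g A \<partial>\<rho>) - ln (\<integral>A. exp (g A) \<partial>\<pi>))"
    by (intro ennreal_leI) simp
  also have "\<dots> \<le> KL \<rho> \<pi>"
    by (rule KL_variational[OF p(1) r(1) _ measurable_posterior[OF \<pi> g], of "\<bar>c\<bar>"])
      (use g_bound in \<open>simp_all add: p(2,3) r(2)\<close>)
  finally show ?thesis by (simp add: g_def)
qed

text \<open>The variational inequality is linear in the gap, so for every slope it already concerns
  the \<open>\<rho>\<close>-mean \<open>G\<close>; the grid then bounds the square of that mean. A
  nonpositive \<open>G\<close> or an infinite divergence makes the claim trivial.\<close>

lemma labeled_bound:
  assumes nL: "2 \<le> nL" "nL < n" and \<delta>: "0 < \<delta>" "\<delta> \<le> 1"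
    and q: "q = real nL * real (n - nL) / real n"
    and cover: "grid_cover K y q B \<theta> (t_factor nL n)" and "0 < \<theta>"
    and \<pi>: "\<pi> \<in> space (prob_algebra \<A>)" and \<rho>: "\<rho> \<in> space (prob_algebra \<A>)"
    and S: "S \<in> space data" and I: "I \<subseteq> {..<n}" "card I = nL"
    and mgf: "\<And>k. k < K \<Longrightarrow> labeled_mgf \<pi> (2 * q * y k) I S
      \<le> ennreal (1 / \<delta> / (\<theta> / real K * exp (- (B * (y k)\<^sup>2 / 2))))"
  shows "ereal (real (n - nL) / real n * (\<integral>A. subset_gap n (\<lambda>i. task_emp A (S i)) I \<partial>\<rho>))
    \<le> labeled_task_term n nL \<delta> \<rho> \<pi>"
proof (cases "KL \<rho> \<pi>")
  case top
  \<comment> \<open>Strict positivity matters: a factor 0 times \<open>\<infinity>\<close> would be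
    0 and the term would not be infinite.\<close>
  have "0 < 1 - real nL / real n" using nL by simp
  then have "labeled_task_term n nL \<delta> \<rho> \<pi> = \<infinity>"
    using nL by (simp add: labeled_task_term_def ereal_sqrt_def top)
  then show ?thesis by simp
next
  case (real r)
  define G where "G = (\<integral>A. subset_gap n (\<lambda>i. task_emp A (S i)) I \<partial>\<rho>)"
  define u where "u = real (n - nL) / real n"
  have u: "1 - real nL / real n = u" "0 < u" using nL by (auto simp: u_def of_nat_diff field_simps)
  have I': "0 < card I" "card I < n" using I nL by auto
  note r = prob_algebra_facts[OF \<rho>]
  have "G \<in> {-1..1}" unfolding G_def
    by (rule prob_space.integral_bounds(2)[OF r(1) measurable_posterior[OF \<rho> labeled_gap_facts(1)[OF S I(1) I']]])
      (simp only: r(3) labeled_gap_facts(2)[OF S I(1) I'])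
  then have "G \<le> 1" by simp
  have t: "1 \<le> t_factor nL n" using t_factor_ge_1[OF nL] .
  then have log: "0 \<le> ln (t_factor nL n / \<delta>)" using \<delta> by (simp add: field_simps)
  have "u * G \<le> sqrt (u * ((r + ln (t_factor nL n / \<delta>)) / (2 * real nL)))"
  proof (cases "0 < G")
    case True
    have "2 * q * G\<^sup>2 \<le> r + ln (t_factor nL n / \<delta>)"
    proof (rule grid_cover_bound_mgf[OF cover \<open>0 < \<theta>\<close> _ \<delta> _ \<open>G \<le> 1\<close> True])
      fix k assume "k < K"
      from KL_ge_labeled[OF \<pi> \<rho> S I(1) I' mgf[OF this]]
      show "ennreal (2 * q * y k * G - ln (1 / \<delta> / (\<theta> / real K * exp (- (B * (y k)\<^sup>2 / 2))))) \<le> ennreal r"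
        by (simp add: G_def real)
    qed (use t real in auto)
    \<comment> \<open>With \<open>q = nL * u\<close>, one factor \<open>u\<close> of the square is
      absorbed into \<open>q\<close> and the other becomes the factor \<open>1 - nL / n\<close> of
      the radicand.\<close>
    moreover have "(u * G)\<^sup>2 = u * (2 * q * G\<^sup>2 / (2 * real nL))"
      using nL by (simp add: q u_def power2_eq_square)
    ultimately have "(u * G)\<^sup>2 \<le> u * ((r + ln (t_factor nL n / \<delta>)) / (2 * real nL))"
      using u(2) by (simp only:) (intro mult_left_mono divide_right_mono, auto)
    then show ?thesis by (rule real_le_rsqrt)
  next
    case False
    then have "u * G \<le> 0" using u(2) by (simp add: mult_nonneg_nonpos)
    also have "0 \<le> sqrt (u * ((r + ln (t_factor nL n / \<delta>)) / (2 * real nL)))"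
      using u(2) log real by simp
    finally show ?thesis .
  qed
  moreover have "labeled_task_term n nL \<delta> \<rho> \<pi> = ereal (sqrt (u * ((r + ln (t_factor nL n / \<delta>)) / (2 * real nL))))"
    using nL real by (simp add: labeled_task_term_def ereal_sqrt_def u(1))
  ultimately show ?thesis unfolding G_def[symmetric] u_def[symmetric] by (simp only: ereal_less_eq)
qed

text \<open>The square-root bound is proved for each algorithm separately on the same event and only
  then integrated over \<open>\<rho>\<close>. Hence the expectation stands outside the root, and a
  possibly non-measurable right-hand side is harmless.\<close>

lemma sample_bound:
  assumes n: "3 \<le> m * n" and \<delta>: "0 < \<delta>" "\<delta> \<le> 1"
    and \<P>: "\<P> \<in> space (prob_algebra (prob_algebra \<F>))" and \<rho>: "\<rho> \<in> space (prob_algebra \<A>)"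
    and \<Q>: "\<Q> \<in> space \<A> \<rightarrow> space (prob_algebra (prob_algebra \<F>))"
    and S: "S \<in> space data"
    and cover: "grid_cover N y (real (m * n)) (real (m * n)) \<theta> (8 * exp 1 * real (m * n))" and "0 < \<theta>"
    and mgf: "\<And>k. k < N \<Longrightarrow> prior_mgf \<P> (y k) S
      \<le> ennreal (1 / \<delta> / (\<theta> / real N * exp (- (real (m * n) * (y k)\<^sup>2 / 2))))"
  shows "ereal (\<integral>A. (\<Sum>i<n. task_risk i A (S i) - task_emp A (S i)) / real n \<partial>\<rho>)
    \<le> sample_term n m \<delta> S \<rho> \<Q> \<P>"
proof -
  note r = prob_algebra_facts[OF \<rho>]
  define G where "G A = (\<Sum>i<n. task_risk i A (S i) - task_emp A (S i)) / real n" for A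
  define R where "R A = ereal_sqrt ((enn2ereal (complexity n m S A \<Q> \<P>) + ereal (ln (8 * real m * real n / \<delta>) + 1))
         / ereal (2 * real m * real n))" for A
  have mn: "0 < m" "0 < n" using n by (auto intro: Nat.gr0I)
  have "ennreal (G A) \<le> e2ennreal (R A)" if A: "A \<in> space \<A>" for A
  proof (cases "complexity n m S A \<Q> \<P>")
    case top
    then have "R A = \<infinity>" using mn by (simp add: R_def ereal_sqrt_def)
    then show ?thesis by (simp add: e2ennreal_infty)
  next
    case (real c)
    show ?thesis
    proof (cases "0 < G A")
      case True
      have "(\<Sum>i<n. task_risk i A (S i) - task_emp A (S i)) \<le> (\<Sum>i<n. 1)"
      proof (rule sum_mono)
        fix i assume "i \<in> {..<n}"
        then show "task_risk i A (S i) - task_emp A (S i) \<le> 1"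
          using task_risk_range[OF A data_component_space[OF S], of i i] task_emp_range[OF A data_component_space[OF S], of i] by simp
      qed
      then have "G A \<le> 1" using mn by (simp add: G_def)
      have "2 * real (m * n) * (G A)\<^sup>2 \<le> c + ln (8 * exp 1 * real (m * n) / \<delta>)"
      proof (rule grid_cover_bound_mgf[OF cover \<open>0 < \<theta>\<close> _ \<delta> _ \<open>G A \<le> 1\<close> True])
        fix k assume k: "k < N"
        have y: "0 < y k" using cover k by (simp add: grid_cover_def)
        have "2 * real m * y k * (\<Sum>i<n. task_risk i A (S i) - task_emp A (S i)) = 2 * real (m * n) * y k * G A"
          using mn by (simp add: G_def)
        then show "ennreal (2 * real (m * n) * y k * G A
            - ln (1 / \<delta> / (\<theta> / real N * exp (- (real (m * n) * (y k)\<^sup>2 / 2))))) \<le> ennreal c"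
          using complexity_ge[OF data_component_space[OF S] A \<P> _ y mgf[OF k], of \<Q>] \<Q> A
          by (simp only: real) auto
      qed (use mn real in auto)
      \<comment> \<open>The factor e of the threshold becomes the summand 1 of the radicand.\<close>
      also have "8 * exp 1 * real (m * n) / \<delta> = 8 * real m * real n / \<delta> * exp 1" by simp
      also have "ln \<dots> = ln (8 * real m * real n / \<delta>) + 1"
        using mn \<delta> by (subst ln_mult) auto
      finally have "(G A)\<^sup>2 \<le> (c + (ln (8 * real m * real n / \<delta>) + 1)) / (2 * real m * real n)"
        using mn by (subst pos_le_divide_eq) (auto simp: mult_ac)
      then have "G A \<le> sqrt ((c + (ln (8 * real m * real n / \<delta>) + 1)) / (2 * real m * real n))"
        by (rule real_le_rsqrt)
      moreover have "R A = ereal (sqrt ((c + (ln (8 * real m * real n / \<delta>) + 1)) / (2 * real m * real n)))"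
        using mn real by (simp add: R_def ereal_sqrt_def)
      ultimately show ?thesis
        by (simp add: e2ennreal_ereal ennreal_leI)
    next
      case False
      then show ?thesis by (simp add: ennreal_neg)
    qed
  qed
  then have "(\<integral>\<^sup>+A. ennreal (G A) \<partial>\<rho>) \<le> (\<integral>\<^sup>+A. e2ennreal (R A) \<partial>\<rho>)"
    by (intro nn_integral_mono) (simp add: r(3))
  then have "ennreal (\<integral>A. G A \<partial>\<rho>) \<le> (\<integral>\<^sup>+A. e2ennreal (R A) \<partial>\<rho>)"
    by (rule order_trans[OF ennreal_integral_le_nn_integral])
  then have "enn2ereal (ennreal (\<integral>A. G A \<partial>\<rho>)) \<le> sample_term n m \<delta> S \<rho> \<Q> \<P>"
    by (simp add: sample_term_def R_def less_eq_ennreal.rep_eq)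
  moreover have "ereal (\<integral>A. G A \<partial>\<rho>) \<le> enn2ereal (ennreal (\<integral>A. G A \<partial>\<rho>))"
    by (simp add: enn2ereal_ennreal max_def ennreal.rep_eq)
  ultimately show ?thesis by (simp add: G_def)
qed

text \<open>The average empirical risk of all tasks is added and subtracted, and
  \<open>average_eq_subset_gap\<close> rewrites its distance from the labeled average. Boundedness
  of the risks makes all three pieces integrable.\<close>

lemma risk_decomposition:
  assumes \<rho>: "\<rho> \<in> space (prob_algebra \<A>)"
    and S: "S \<in> space data" and I: "I \<subseteq> {..<n}" "card I = nL" "0 < nL" "nL < n"
  shows "true_risk n m D loss S \<rho> = training_risk nL m loss I S \<rho>
    + real (n - nL) / real n * (\<integral>A. subset_gap n (\<lambda>i. task_emp A (S i)) I \<partial>\<rho>)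
    + (\<integral>A. (\<Sum>i<n. task_risk i A (S i) - task_emp A (S i)) / real n \<partial>\<rho>)"
proof -
  note r = prob_algebra_facts[OF \<rho>]
  have I': "0 < card I" "card I < n" using I by auto
  have Si: "S i \<in> space dataset_space" if "i < n" for i using data_component_space[OF S that] .
  have emp: "integrable \<rho> (\<lambda>A. task_emp A (S i))" if "i < n" for i
    by (rule prob_space.integral_bounds(1)[OF r(1) measurable_posterior[OF \<rho> task_emp_measurable1[OF Si[OF that]]], of 0 1])
      (simp only: r(3) task_emp_range Si[OF that])
  have risk: "integrable \<rho> (\<lambda>A. task_risk i A (S i))" if "i < n" for i
    by (rule prob_space.integral_bounds(1)[OF r(1) measurable_posterior[OF \<rho> task_risk_measurable1[OF that Si[OF that]]], of 0 1])
      (simp only: r(3) task_risk_range Si[OF that] that)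
  have gap: "integrable \<rho> (\<lambda>A. subset_gap n (\<lambda>i. task_emp A (S i)) I)"
    by (rule prob_space.integral_bounds(1)[OF r(1) measurable_posterior[OF \<rho> labeled_gap_facts(1)[OF S I(1) I']], of "-1" 1])
      (simp only: r(3) labeled_gap_facts(2)[OF S I(1) I'])
  have sub: "integrable \<rho> (\<lambda>A. (\<Sum>i\<in>I. task_emp A (S i)) / real nL)"
    using I emp by (intro integrable_divide Bochner_Integration.integrable_sum) auto
  have dif: "integrable \<rho> (\<lambda>A. (\<Sum>i<n. task_risk i A (S i) - task_emp A (S i)) / real n)"
    using emp risk by (intro integrable_divide Bochner_Integration.integrable_sum Bochner_Integration.integrable_diff) auto
  have "true_risk n m D loss S \<rho> = (\<integral>A. (\<Sum>i<n. task_risk i A (S i)) / real n \<partial>\<rho>)"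
    unfolding true_risk_def
  proof (rule Bochner_Integration.integral_cong[OF refl])
    fix A assume "A \<in> space \<rho>"
    then have "(\<integral>(x, y). (\<integral>f. loss y (f x) \<partial>A (inputs m (S i))) \<partial>D i) = task_risk i A (S i)" if "i < n" for i
      using task_risk_eq[OF _ Si[OF that] that] by (simp add: r(3))
    then show "1 / real n * (\<Sum>i<n. \<integral>(x, y). (\<integral>f. loss y (f x) \<partial>A (inputs m (S i))) \<partial>D i)
        = (\<Sum>i<n. task_risk i A (S i)) / real n" by simp
  qed
  also have "\<dots> = (\<integral>A. (\<Sum>i\<in>I. task_emp A (S i)) / real nL
      + real (n - nL) / real n * subset_gap n (\<lambda>i. task_emp A (S i)) I
      + (\<Sum>i<n. task_risk i A (S i) - task_emp A (S i)) / real n \<partial>\<rho>)"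
  proof (rule Bochner_Integration.integral_cong[OF refl])
    fix A
    show "(\<Sum>i<n. task_risk i A (S i)) / real n = (\<Sum>i\<in>I. task_emp A (S i)) / real nL
      + real (n - nL) / real n * subset_gap n (\<lambda>i. task_emp A (S i)) I
      + (\<Sum>i<n. task_risk i A (S i) - task_emp A (S i)) / real n"
      using average_eq_subset_gap[OF I(1) I', of "\<lambda>i. task_emp A (S i)"]
      by (simp only: I(2) sum_subtractf diff_divide_distrib)
  qed
  also have "\<dots> = (\<integral>A. (\<Sum>i\<in>I. task_emp A (S i)) / real nL \<partial>\<rho>)
    + real (n - nL) / real n * (\<integral>A. subset_gap n (\<lambda>i. task_emp A (S i)) I \<partial>\<rho>)
    + (\<integral>A. (\<Sum>i<n. task_risk i A (S i) - task_emp A (S i)) / real n \<partial>\<rho>)"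
    using gap sub dif
    by (subst Bochner_Integration.integral_add, simp, simp, subst Bochner_Integration.integral_add, simp_all)
  also have "(\<integral>A. (\<Sum>i\<in>I. task_emp A (S i)) / real nL \<partial>\<rho>) = training_risk nL m loss I S \<rho>"
    unfolding training_risk_def
  proof (rule Bochner_Integration.integral_cong[OF refl])
    fix A assume "A \<in> space \<rho>"
    then have "1 / real m * (\<Sum>j<m. \<integral>f. loss (snd (S i j)) (f (fst (S i j))) \<partial>A (inputs m (S i))) = task_emp A (S i)"
      if "i \<in> I" for i
    proof -
      have "i < n" using that I(1) by auto
      then show ?thesis using task_emp_eq[OF _ Si, of A i] \<open>A \<in> space \<rho>\<close> by (simp add: r(3))
    qed
    then show "(\<Sum>i\<in>I. task_emp A (S i)) / real nL = 1 / real nL * (\<Sum>i\<in>I. 1 / real m *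
        (\<Sum>j<m. \<integral>f. loss (snd (S i j)) (f (fst (S i j))) \<partial>A (inputs m (S i))))"
      by simp
  qed
  finally show ?thesis .
qed

end

section \<open>Combining the two mixtures in one application of Markov's inequality\<close>

theorem theoremA1:
  fixes X :: "'x measure" and Y :: "'y measure"
    and \<F> :: "('x, 'y) model measure"
    and \<A> :: "('x, 'y) algorithm measure"
    and loss :: "'y \<Rightarrow> 'y \<Rightarrow> real"
    and D :: "nat \<Rightarrow> ('x \<times> 'y) measure"
    and \<pi> :: "('x, 'y) algorithm measure"
    and \<P> :: "('x, 'y) model measure measure"
    and n nL m :: nat and \<delta> :: real
  assumes "2 \<le> nL" and "nL < n" and "1 \<le> m" and "\<delta> > 0"
    and distributions: "\<And>i. i < n \<Longrightarrow> D i \<in> space (prob_algebra (X \<Otimes>\<^sub>M Y))"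
    and models: "space \<F> \<subseteq> space X \<rightarrow> space Y"
    and loss_range: "\<And>y y'. y \<in> space Y \<Longrightarrow> y' \<in> space Y \<Longrightarrow> loss y y' \<in> {0..1}"
    and loss_measurable:
      "(\<lambda>((x, y), f). loss y (f x)) \<in> borel_measurable ((X \<Otimes>\<^sub>M Y) \<Otimes>\<^sub>M \<F>)"
    and algorithms:
      "\<And>A xs. A \<in> space \<A> \<Longrightarrow> xs \<in> lists (space X) \<Longrightarrow> A xs \<in> space (prob_algebra \<F>)"
    and algorithms_measurable:
      "(\<lambda>(A, x). A (map x [0..<m])) \<in> \<A> \<Otimes>\<^sub>M (\<Pi>\<^sub>M j\<in>{..<m}. X) \<rightarrow>\<^sub>M prob_algebra \<F>"
    and meta_prior: "\<pi> \<in> space (prob_algebra \<A>)"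
    and hyper_prior: "\<P> \<in> space (prob_algebra (prob_algebra \<F>))"
  shows "\<exists>E \<in> sets (sampling n nL m D). measure (sampling n nL m D) E \<ge> 1 - \<delta> \<and>
    (\<forall>(I, S) \<in> E. \<forall>\<rho> \<in> space (prob_algebra \<A>).
       \<forall>\<Q> \<in> space \<A> \<rightarrow> space (prob_algebra (prob_algebra \<F>)).
         ereal (true_risk n m D loss S \<rho>) \<le> ereal (training_risk nL m loss I S \<rho>)
           + labeled_task_term n nL \<delta> \<rho> \<pi> + sample_term n m \<delta> S \<rho> \<Q> \<P>)"
proof (cases "1 \<le> \<delta>")
  case True
  \<comment> \<open>For \<open>\<delta> \<ge> 1\<close> the required probability is at most 0, so
    the empty event will do.\<close>
  then show ?thesis by (intro bexI[of _ "{}"]) auto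
next
  case False
  then have \<delta>: "0 < \<delta>" "\<delta> \<le> 1" using \<open>\<delta> > 0\<close> by auto
  interpret multi_task X Y \<F> \<A> loss D n m
    by unfold_locales (fact assms)+
  define fam where "fam = {I. I \<subseteq> {..<n} \<and> card I = nL}"
  define q where "q = real nL * real (n - nL) / real n"
  obtain p K y where p: "p \<in> {nL, n - nL}"
    and cover: "grid_cover K y q (serfling_factor p n) (47/50) (t_factor nL n)"
    using labeled_cover[OF assms(1,2) q_def] by blast
  define B where "B = serfling_factor p n"
  define N where "N = m * n"
  have "3 * 1 \<le> n * m" using assms(1-3) by (intro mult_le_mono) auto
  then have N: "3 \<le> N" by (simp add: N_def mult.commute)
  define z where "z k = (2 * real k + 1) / real N" for k
  have cover': "grid_cover N z (real N) (real N) (3/50) (8 * exp 1 * real N)"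
    unfolding z_def by (rule sample_cover[OF N])
  have "0 < K" using cover by (simp add: grid_cover_def)
  \<comment> \<open>The weight 47/50 is spread evenly over the \<open>K\<close> slopes, and the
    exponential cancels the bound on the corresponding moment generating function; likewise for
    \<open>d\<close> with 3/50 and \<open>N\<close>.\<close>
  define c where "c k = 47/50 / real K * exp (- (B * (y k)\<^sup>2 / 2))" for k
  define d where "d k = 3/50 / real N * exp (- (real N * (z k)\<^sup>2 / 2))" for k
  have c: "0 < c k" and d: "0 < d k" for k
    using \<open>0 < K\<close> N by (auto simp: c_def d_def)
  define G where "G I S = (\<Sum>k<K. ennreal (c k) * labeled_mgf \<pi> (2 * q * y k) I S)
    + (\<Sum>k<N. ennreal (d k) * prior_mgf \<P> (z k) S)" for I S
  have fam: "finite fam" "fam \<noteq> {}"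
  proof -
    show "finite fam" unfolding fam_def by simp
    have "{..<nL} \<in> fam" using assms(2) by (auto simp: fam_def)
    then show "fam \<noteq> {}" by blast
  qed
  have samp: "sampling n nL m D = measure_pmf (pmf_of_set fam) \<Otimes>\<^sub>M data"
    by (simp add: sampling_def fam_def)
  have lm: "labeled_mgf \<pi> a I \<in> borel_measurable data" if "I \<in> fam" for I a
    using that by (intro labeled_mgf_measurable[OF meta_prior]) (simp add: fam_def)
  note pm = prior_mgf_measurable[OF hyper_prior]
  have G_meas: "G I \<in> borel_measurable data" if "I \<in> fam" for I
    unfolding G_def using lm[OF that] pm
    by (intro borel_measurable_add borel_measurable_sum borel_measurable_times_ennreal) auto
  have "(\<Sum>I\<in>fam. \<integral>\<^sup>+S. G I S \<partial>data)
    = (\<Sum>I\<in>fam. (\<Sum>k<K. ennreal (c k) * (\<integral>\<^sup>+S. labeled_mgf \<pi> (2 * q * y k) I S \<partial>data))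
        + (\<Sum>k<N. ennreal (d k) * (\<integral>\<^sup>+S. prior_mgf \<P> (z k) S \<partial>data)))"
  proof (rule sum.cong[OF refl])
    fix I assume I: "I \<in> fam"
    note [measurable] = lm[OF I] pm
    show "(\<integral>\<^sup>+S. G I S \<partial>data) = (\<Sum>k<K. ennreal (c k) * (\<integral>\<^sup>+S. labeled_mgf \<pi> (2 * q * y k) I S \<partial>data))
        + (\<Sum>k<N. ennreal (d k) * (\<integral>\<^sup>+S. prior_mgf \<P> (z k) S \<partial>data))"
      unfolding G_def by (simp add: nn_integral_add nn_integral_sum nn_integral_cmult)
  qed
  also have "\<dots> = (\<Sum>k<K. ennreal (c k) * (\<Sum>I\<in>fam. \<integral>\<^sup>+S. labeled_mgf \<pi> (2 * q * y k) I S \<partial>data))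
      + (\<Sum>I\<in>fam. \<Sum>k<N. ennreal (d k) * (\<integral>\<^sup>+S. prior_mgf \<P> (z k) S \<partial>data))"
    unfolding sum.distrib sum_distrib_left by (subst sum.swap) (rule refl)
  also have "\<dots> \<le> (\<Sum>k<K. ennreal (47/50 / real K * real (card fam))) + (\<Sum>I\<in>fam. \<Sum>k<N. ennreal (3/50 / real N))"
  proof (intro add_mono sum_mono)
    fix k assume "k \<in> {..<K}"
    have "ennreal (c k) * (\<Sum>I\<in>fam. \<integral>\<^sup>+S. labeled_mgf \<pi> (2 * q * y k) I S \<partial>data)
      \<le> ennreal (c k) * ennreal (real (card fam) * exp (B * (y k)\<^sup>2 / 2))"
      using labeled_mgf_expectation[OF meta_prior _ assms(2) q_def p, of "y k"] assms(1)
      by (intro mult_left_mono) (simp_all add: fam_def B_def)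
    also have "\<dots> = ennreal (47/50 / real K * real (card fam))"
      using c[of k] by (simp add: ennreal_mult[symmetric] less_imp_le) (simp add: c_def exp_minus)
    finally show "ennreal (c k) * (\<Sum>I\<in>fam. \<integral>\<^sup>+S. labeled_mgf \<pi> (2 * q * y k) I S \<partial>data)
      \<le> ennreal (47/50 / real K * real (card fam))" .
  next
    fix k
    have "ennreal (d k) * (\<integral>\<^sup>+S. prior_mgf \<P> (z k) S \<partial>data) \<le> ennreal (d k) * ennreal (exp (real N * (z k)\<^sup>2 / 2))"
      using prior_mgf_expectation[OF hyper_prior, of "z k"] by (intro mult_left_mono) (simp_all add: N_def)
    also have "\<dots> = ennreal (3/50 / real N)"
      using d[of k] by (simp add: ennreal_mult[symmetric] less_imp_le) (simp add: d_def exp_minus)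
    finally show "ennreal (d k) * (\<integral>\<^sup>+S. prior_mgf \<P> (z k) S \<partial>data) \<le> ennreal (3/50 / real N)" .
  qed
  also have "\<dots> = ennreal ((\<Sum>k<K. 47/50 / real K * real (card fam)) + (\<Sum>I\<in>fam. \<Sum>k<N. 3/50 / real N))"
    by (simp only: sum_ennreal ennreal_plus sum_nonneg divide_nonneg_nonneg mult_nonneg_nonneg of_nat_0_le_iff
        zero_le_divide_iff zero_le_numeral simp_thms)
  \<comment> \<open>The two weights add up to 1, so the mixture averaged over \<open>fam\<close> has
    expectation at most 1.\<close>
  also have "(\<Sum>k<K. 47/50 / real K * real (card fam)) + (\<Sum>I\<in>fam. \<Sum>k<N. 3/50 / real N) = real (card fam)"
    using \<open>0 < K\<close> N by simp
  finally have "(\<Sum>I\<in>fam. \<integral>\<^sup>+S. G I S \<partial>data) \<le> ennreal (real (card fam))" .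
  from pmf_of_set_pair_markov[OF data_prob fam G_meas this \<delta>(1)] obtain E
    where E: "E \<in> sets (sampling n nL m D)" "1 - \<delta> \<le> measure (sampling n nL m D) E"
      and good: "\<And>I S. (I, S) \<in> E \<Longrightarrow> I \<in> fam \<and> S \<in> space data \<and> G I S \<le> ennreal (1 / \<delta>)"
    unfolding samp by blast
  have "ereal (true_risk n m D loss S \<rho>) \<le> ereal (training_risk nL m loss I S \<rho>)
      + labeled_task_term n nL \<delta> \<rho> \<pi> + sample_term n m \<delta> S \<rho> \<Q> \<P>"
    if "(I, S) \<in> E" and \<rho>: "\<rho> \<in> space (prob_algebra \<A>)"
      and \<Q>: "\<Q> \<in> space \<A> \<rightarrow> space (prob_algebra (prob_algebra \<F>))" for I S \<rho> \<Q>
  proof -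
    have I: "I \<subseteq> {..<n}" "card I = nL" and S: "S \<in> space data" and le: "G I S \<le> ennreal (1 / \<delta>)"
      using good[OF that(1)] by (auto simp: fam_def)
    \<comment> \<open>All summands of \<open>G\<close> are nonnegative, so the single bound on
      \<open>G\<close> holds for every component of both mixtures at once, without a union
      bound.\<close>
    have lab: "labeled_mgf \<pi> (2 * q * y k) I S \<le> ennreal (1 / \<delta> / c k)" if "k < K" for k
    proof (rule ennreal_mult_le_divide[OF c])
      have "ennreal (c k) * labeled_mgf \<pi> (2 * q * y k) I S \<le> (\<Sum>k<K. ennreal (c k) * labeled_mgf \<pi> (2 * q * y k) I S)"
        using that by (intro member_le_sum) auto
      also have "\<dots> \<le> G I S" unfolding G_def by simp
      finally show "ennreal (c k) * labeled_mgf \<pi> (2 * q * y k) I S \<le> ennreal (1 / \<delta>)" using le by (rule order_trans)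
    qed (use \<delta> in simp)
    have pri: "prior_mgf \<P> (z k) S \<le> ennreal (1 / \<delta> / d k)" if "k < N" for k
    proof (rule ennreal_mult_le_divide[OF d])
      have "ennreal (d k) * prior_mgf \<P> (z k) S \<le> (\<Sum>k<N. ennreal (d k) * prior_mgf \<P> (z k) S)"
        using that by (intro member_le_sum) auto
      also have "\<dots> \<le> G I S" unfolding G_def by simp
      finally show "ennreal (d k) * prior_mgf \<P> (z k) S \<le> ennreal (1 / \<delta>)" using le by (rule order_trans)
    qed (use \<delta> in simp)
    have 1: "ereal (real (n - nL) / real n * (\<integral>A. subset_gap n (\<lambda>i. task_emp A (S i)) I \<partial>\<rho>))
        \<le> labeled_task_term n nL \<delta> \<rho> \<pi>"
      by (rule labeled_bound[OF assms(1,2) \<delta> q_def cover _ meta_prior \<rho> S I])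
        (use lab in \<open>simp_all add: c_def B_def\<close>)
    have 2: "ereal (\<integral>A. (\<Sum>i<n. task_risk i A (S i) - task_emp A (S i)) / real n \<partial>\<rho>)
        \<le> sample_term n m \<delta> S \<rho> \<Q> \<P>"
      by (rule sample_bound[OF N[unfolded N_def] \<delta> hyper_prior \<rho> \<Q> S cover'[unfolded N_def]])
        (use pri in \<open>simp_all add: d_def N_def\<close>)
    have "0 < nL" using assms(1) by simp
    note risk_decomposition[OF \<rho> S I this assms(2)]
    then show ?thesis
      using add_mono[OF add_mono[OF order_refl[of "ereal (training_risk nL m loss I S \<rho>)"] 1] 2] by simp
  qed
  then show ?thesis using E by (intro bexI[of _ E]) auto
qed

end
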